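(* Let $n\ge 3$ and let $\ell=(\ell_1,\ldots,\ell_n)$ be a generic length vector. Then there is an isomorphism of real vector bundles over $\overline M(\ell)$ $$\tau(\overline M(\ell))\oplus\varepsilon\;\approx\;(n-2)\,\xi,$$ where $\tau(\overline M(\ell))$ is the tangent bundle, $\varepsilon$ is a trivial line bundle, $\xi$ is the canonical line bundle over $\overline M(\ell)$, and $(n-2)\xi$ denotes the Whitney sum of $n-2$ copies of $\xi$.
   Context: A length vector $\ell=(\ell_1,\ldots,\ell_n)$ is an $n$-tuple of positive real numbers; it is generic if there is no $S\subset\{1,\ldots,n\}$ with $\sum_{i\in S}\ell_i=\sum_{i\notin S}\ell_i$. $M(\ell)$ is the space of $n$-gons in the plane with successive side lengths $\ell_1,\ldots,\ell_n$, identified under oriented (orientation-preserving) isometry; concretely $M(\ell)=F^{-1}(\ell_n)$ where $F:(S^1)^{n-1}\to\mathbb C$, $F(z_1,\ldots,z_{n-1})=\sum_{j=1}^{n-1}\ell_jz_j$. $\overline M(\ell)$ is the space of such $n$-gons identified under all isometries; concretely it is the quotient of $M(\ell)$ by the involution $\phi(z_1,\ldots,z_{n-1})=(\bar z_1,\ldots,\bar z_{n-1})$ (complex conjugation), which is free when $\ell$ is generic. For generic $\ell$ both are closed smooth $(n-3)$-manifolds. The canonical line bundle $\xi$ is the real line bundle over $\overline M(\ell)$ associated with the double cover $p:M(\ell)\to\overline M(\ell)$, i.e. $\xi=M(\ell)\times\mathbb R/\big((x,t)\sim(\phi(x),-t)\big)$. *)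

theory Defs
  imports "HOL-Analysis.Analysis"
begin

section \<open>Quotient topology and orbits of an involution\<close>

definition quotient_topology :: "'a topology \<Rightarrow> ('a \<Rightarrow> 'b) \<Rightarrow> 'b topology" where
  "quotient_topology X p =
     topology (\<lambda>V. V \<subseteq> p ` topspace X \<and> openin X {x \<in> topspace X. p x \<in> V})"

lemma openin_quotient_topology:
  "openin (quotient_topology X p) V \<longleftrightarrow>
     V \<subseteq> p ` topspace X \<and> openin X {x \<in> topspace X. p x \<in> V}"
proof -
  have inter: "{x \<in> topspace X. p x \<in> S \<inter> T} =
      {x \<in> topspace X. p x \<in> S} \<inter> {x \<in> topspace X. p x \<in> T}" for S T
    by blast
  have union: "{x \<in> topspace X. p x \<in> \<Union>K} = (\<Union>T\<in>K. {x \<in> topspace X. p x \<in> T})" for K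
    by blast
  have "istopology (\<lambda>V. V \<subseteq> p ` topspace X \<and> openin X {x \<in> topspace X. p x \<in> V})"
    unfolding istopology_def inter union by (auto intro!: openin_Union)
  then show ?thesis
    unfolding quotient_topology_def by (simp only: topology_inverse')
qed

lemma topspace_quotient_topology: "topspace (quotient_topology X p) = p ` topspace X"
proof -
  have "{x \<in> topspace X. p x \<in> p ` topspace X} = topspace X"
    by blast
  then have "openin (quotient_topology X p) (p ` topspace X)"
    by (simp add: openin_quotient_topology)
  then show ?thesis
    by (meson openin_quotient_topology openin_subset openin_topspace subset_antisym)
qed

lemma quotient_map_quotient_topology: "quotient_map X (quotient_topology X p) p"
  by (auto simp: quotient_map_def topspace_quotient_topology openin_quotient_topology)

definition orbit :: "('a \<Rightarrow> 'a) \<Rightarrow> 'a \<Rightarrow> 'a set" where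
  "orbit \<phi> x = {x, \<phi> x}"


section \<open>Real vector bundles\<close>

text \<open>
  The operations \<open>vadd\<close> and \<open>vscale\<close> are only meaningful on the total space and,
  for \<open>vadd\<close>, on two vectors of the same fibre.
\<close>

record ('b, 'e) vbundle =
  base :: "'b topology"
  total :: "'e topology"
  proj :: "'e \<Rightarrow> 'b"
  vadd :: "'e \<Rightarrow> 'e \<Rightarrow> 'e"
  vscale :: "real \<Rightarrow> 'e \<Rightarrow> 'e"

definition fibre :: "('b, 'e) vbundle \<Rightarrow> 'b \<Rightarrow> 'e set" where
  "fibre E b = {e \<in> topspace (total E). proj E e = b}"

definition restrict_bundle :: "('b, 'e) vbundle \<Rightarrow> 'b set \<Rightarrow> ('b, 'e) vbundle" where
  "restrict_bundle E U =
     E\<lparr>base := subtopology (base E) U, total := subtopology (total E) {e. proj E e \<in> U}\<rparr>"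

definition trivial_bundle :: "'b topology \<Rightarrow> nat \<Rightarrow> ('b, 'b \<times> (nat \<Rightarrow> real)) vbundle" where
  "trivial_bundle B k =
     \<lparr>base = B,
      total = prod_topology B (Euclidean_space k),
      proj = fst,
      vadd = (\<lambda>(b, v) (b', w). (b, \<lambda>i. v i + w i)),
      vscale = (\<lambda>c (b, v). (b, \<lambda>i. c * v i))\<rparr>"

definition bundle_iso ::
    "('b, 'e) vbundle \<Rightarrow> ('b, 'f) vbundle \<Rightarrow> ('e \<Rightarrow> 'f) \<Rightarrow> bool" where
  "bundle_iso E F h \<longleftrightarrow>
     homeomorphic_map (total E) (total F) h \<and>
     (\<forall>e \<in> topspace (total E). proj F (h e) = proj E e) \<and>
     (\<forall>b \<in> topspace (base E). \<forall>e \<in> fibre E b. \<forall>e' \<in> fibre E b.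
        h (vadd E e e') = vadd F (h e) (h e')) \<and>
     (\<forall>e \<in> topspace (total E). \<forall>c. h (vscale E c e) = vscale F c (h e))"

text \<open>
  That the fibres satisfy the vector space axioms is not listed separately: the fibres are
  closed under the operations, and a local trivialisation is bijective and linear on them.
\<close>

definition vector_bundle :: "('b, 'e) vbundle \<Rightarrow> bool" where
  "vector_bundle E \<longleftrightarrow>
     continuous_map (total E) (base E) (proj E) \<and>
     (\<forall>b \<in> topspace (base E). \<forall>e \<in> fibre E b.
        (\<forall>e' \<in> fibre E b. vadd E e e' \<in> fibre E b) \<and> (\<forall>c. vscale E c e \<in> fibre E b)) \<and>
     (\<forall>b \<in> topspace (base E). \<exists>U k h. openin (base E) U \<and> b \<in> U \<and>
        bundle_iso (restrict_bundle E U) (trivial_bundle (subtopology (base E) U) k) h)"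

definition isomorphic_bundles ::
    "('b, 'e) vbundle \<Rightarrow> ('b, 'f) vbundle \<Rightarrow> bool" (infix \<open>\<approx>\<^sub>b\<close> 50) where
  "E \<approx>\<^sub>b F \<longleftrightarrow>
     vector_bundle E \<and> vector_bundle F \<and> base E = base F \<and> (\<exists>h. bundle_iso E F h)"

definition whitney_sum ::
    "('b, 'e) vbundle \<Rightarrow> ('b, 'f) vbundle \<Rightarrow> ('b, 'e \<times> 'f) vbundle" (infixl \<open>\<oplus>\<^sub>b\<close> 65) where
  "E \<oplus>\<^sub>b F =
     \<lparr>base = base E,
      total = subtopology (prod_topology (total E) (total F)) {(e, f). proj E e = proj F f},
      proj = (\<lambda>(e, f). proj E e),
      vadd = (\<lambda>(e, f) (e', f'). (vadd E e e', vadd F f f')),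
      vscale = (\<lambda>c (e, f). (vscale E c e, vscale F c f))\<rparr>"

text \<open>
  The \<open>k\<close>-fold Whitney sum has as points the pairs of a base point \<open>b\<close> and a \<open>k\<close>-tuple of
  vectors over \<open>b\<close>; recording \<open>b\<close> makes the case \<open>k = 0\<close> the zero bundle.
\<close>

definition whitney_multiple ::
    "nat \<Rightarrow> ('b, 'e) vbundle \<Rightarrow> ('b, 'b \<times> (nat \<Rightarrow> 'e)) vbundle" where
  "whitney_multiple k E =
     \<lparr>base = base E,
      total = subtopology (prod_topology (base E) (product_topology (\<lambda>_. total E) {..<k}))
                {(b, s). s \<in> (\<Pi>\<^sub>E i\<in>{..<k}. fibre E b)},
      proj = fst,
      vadd = (\<lambda>(b, s) (b', t). (b, \<lambda>i\<in>{..<k}. vadd E (s i) (t i))),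
      vscale = (\<lambda>c (b, s). (b, \<lambda>i\<in>{..<k}. vscale E c (s i)))\<rparr>"

text \<open>
  The line bundle \<open>X \<times> \<real> / ((x, t) \<sim> (\<phi> x, - t))\<close> of the double cover \<open>X \<rightarrow> X / \<phi>\<close> defined by
  a free involution \<open>\<phi>\<close>. A point of the total space is a class \<open>{(x, t), (\<phi> x, - t)}\<close>,
  whose image under \<open>fst\<close> is the orbit of \<open>x\<close>; two classes over the same orbit are added
  using representatives with the same first component.
\<close>

definition double_cover_line_bundle ::
    "'a topology \<Rightarrow> ('a \<Rightarrow> 'a) \<Rightarrow> ('a set, ('a \<times> real) set) vbundle" where
  "double_cover_line_bundle X \<phi> =
     \<lparr>base = quotient_topology X (orbit \<phi>),
      total = quotient_topology (prod_topology X euclideanreal) (orbit (\<lambda>(x, t). (\<phi> x, - t))),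
      proj = (\<lambda>e. fst ` e),
      vadd = (\<lambda>e e'. {(x, s + t) | x s t. (x, s) \<in> e \<and> (x, t) \<in> e'}),
      vscale = (\<lambda>c e. {(x, c * t) | x t. (x, t) \<in> e})\<rparr>"


section \<open>Smooth functions and the tangent bundle\<close>

text \<open>
  Smoothness (of class $C^\infty$) on an open set \<open>U\<close>: the function is differentiable
  on \<open>U\<close> and all its directional derivatives are again smooth on \<open>U\<close>.
\<close>

coinductive smooth_on :: "'a::euclidean_space set \<Rightarrow> ('a \<Rightarrow> real) \<Rightarrow> bool" for U where
  "\<lbrakk>\<And>x. x \<in> U \<Longrightarrow> (f has_derivative f' x) (at x); \<And>v. smooth_on U (\<lambda>x. f' x v)\<rbrakk>
     \<Longrightarrow> smooth_on U f"

text \<open>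
  A smooth manifold is represented by its topology together with its algebra of smooth
  real functions, which are taken to be \<open>extensional\<close> so that they are determined by their
  values on the manifold. For a submanifold of a Euclidean space these are the
  functions that extend smoothly to the ambient space locally around each point.
\<close>

definition smooth_functions :: "'a::euclidean_space set \<Rightarrow> ('a \<Rightarrow> real) set" where
  "smooth_functions S =
     {f \<in> extensional S.
        \<forall>x\<in>S. \<exists>U h. open U \<and> x \<in> U \<and> smooth_on U h \<and> (\<forall>y \<in> S \<inter> U. f y = h y)}"

text \<open>
  The smooth structure of the quotient of a submanifold by a free smooth involution: the
  projection is a local diffeomorphism, so a function is smooth iff its pullback is.
\<close>

definition quotient_smooth_functions ::
    "'a::euclidean_space set \<Rightarrow> ('a \<Rightarrow> 'a) \<Rightarrow> ('a set \<Rightarrow> real) set" where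
  "quotient_smooth_functions S \<phi> =
     {f \<in> extensional (orbit \<phi> ` S). (\<lambda>x\<in>S. f (orbit \<phi> x)) \<in> smooth_functions S}"

text \<open>
  Tangent vectors at \<open>x\<close> are the derivations at \<open>x\<close> of the algebra \<open>C\<close> of smooth functions.
\<close>

definition tangent_space ::
    "'a topology \<Rightarrow> ('a \<Rightarrow> real) set \<Rightarrow> 'a \<Rightarrow> (('a \<Rightarrow> real) \<Rightarrow> real) set" where
  "tangent_space X C x =
     {D \<in> extensional C.
        (\<forall>f\<in>C. \<forall>g\<in>C. \<forall>a b.
           D (\<lambda>y\<in>topspace X. a * f y + b * g y) = a * D f + b * D g) \<and>
        (\<forall>f\<in>C. \<forall>g\<in>C. D (\<lambda>y\<in>topspace X. f y * g y) = f x * D g + g x * D f)}"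

text \<open>
  The total space carries the coarsest topology for which the projection and all the
  differentials \<open>(x, D) \<mapsto> D f\<close> of smooth functions \<open>f\<close> are continuous. This is the usual
  topology of the tangent bundle: near any point there are smooth functions on the whole
  manifold whose germs form local coordinates, and their differentials are the fibre
  coordinates of the corresponding chart of the tangent bundle.
\<close>

definition tangent_bundle ::
    "'a topology \<Rightarrow> ('a \<Rightarrow> real) set \<Rightarrow> ('a, 'a \<times> (('a \<Rightarrow> real) \<Rightarrow> real)) vbundle" where
  "tangent_bundle X C =
     \<lparr>base = X,
      total = subtopology (prod_topology X (product_topology (\<lambda>_. euclideanreal) C))
                {(x, D). D \<in> tangent_space X C x},
      proj = fst,
      vadd = (\<lambda>(x, D) (x', D'). (x, \<lambda>f\<in>C. D f + D' f)),
      vscale = (\<lambda>c (x, D). (x, \<lambda>f\<in>C. c * D f))\<rparr>"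


section \<open>Planar polygon spaces\<close>

text \<open>
  An \<open>n\<close>-tuple \<open>(l\<^sub>1, \<dots>, l\<^sub>n)\<close> is a vector indexed by \<open>'m option\<close>, where \<open>'m\<close> has \<open>n - 1\<close>
  elements: \<open>Some j\<close> are the indices of the first \<open>n - 1\<close> sides, which are also the indices
  of the coordinates of \<open>(S\<^sup>1)\<^sup>n\<^sup>-\<^sup>1\<close>, and \<open>None\<close> is the index of the last side.
\<close>

definition length_vector :: "real ^ 'n \<Rightarrow> bool" where
  "length_vector l \<longleftrightarrow> (\<forall>i. 0 < l $ i)"

definition generic :: "real ^ 'n::finite \<Rightarrow> bool" where
  "generic l \<longleftrightarrow> (\<nexists>S. (\<Sum>i\<in>S. l $ i) = (\<Sum>i\<in>-S. l $ i))"

definition torus :: "(complex ^ 'm) set" where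
  "torus = {z. \<forall>j. z $ j \<in> sphere 0 1}"

definition polygon_map :: "real ^ 'm::finite option \<Rightarrow> complex ^ 'm \<Rightarrow> complex" where
  "polygon_map l z = (\<Sum>j\<in>UNIV. of_real (l $ Some j) * z $ j)"

definition polygon_space :: "real ^ 'm::finite option \<Rightarrow> (complex ^ 'm) set" where
  "polygon_space l = {z \<in> torus. polygon_map l z = of_real (l $ None)}"

definition conjugation :: "complex ^ 'm \<Rightarrow> complex ^ 'm" where
  "conjugation z = (\<chi> j. cnj (z $ j))"

text \<open>\<open>M_bar\<close> is the space of polygons up to all isometries.\<close>

definition M_bar :: "real ^ 'm::finite option \<Rightarrow> (complex ^ 'm) set topology" where
  "M_bar l = quotient_topology (top_of_set (polygon_space l)) (orbit conjugation)"

definition tangent_M_bar where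
  "tangent_M_bar l =
     tangent_bundle (M_bar l) (quotient_smooth_functions (polygon_space l) conjugation)"

definition canonical_line_bundle ::
    "real ^ 'm::finite option \<Rightarrow> ((complex ^ 'm) set, ((complex ^ 'm) \<times> real) set) vbundle" where
  "canonical_line_bundle l =
     double_cover_line_bundle (top_of_set (polygon_space l)) conjugation"

end

theory Submission
  imports Defs 
begin

text \<open>
  Let an edge vector \<open>z\<^sub>j\<close> of a polygon rotate with angular velocity \<open>t\<^sub>j\<close>. The end point of the
  polygonal line then moves with the velocity \<open>i \<Sum> l\<^sub>j t\<^sub>j z\<^sub>j\<close>, so the tangent space of the
  polygon space at \<open>z\<close> consists of the tuples \<open>t\<close> with
  \<open>\<Sum> l\<^sub>j t\<^sub>j Re z\<^sub>j = 0\<close> (no vertical velocity) and \<open>\<Sum> l\<^sub>j t\<^sub>j Im z\<^sub>j = 0\<close> (no horizontal velocity).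
  Conjugation reverses all rotations. Hence tuples of \<open>n - 1\<close> angular velocities form
  the bundle \<open>(n - 1) \<xi>\<close> over the quotient, with the tangent bundle as a subbundle of
  codimension two.

  One of the two missing dimensions is a trivial line bundle, the other one is a copy of \<open>\<xi>\<close>, and
  both can be split off by explicit sections. The tuple \<open>j \<mapsto> Im z\<^sub>j\<close> is odd under
  conjugation, so it spans a trivial line in \<open>(n - 1) \<xi>\<close>; its horizontal velocity is
  \<open>- \<Sum> l\<^sub>j (Im z\<^sub>j)\<^sup>2\<close>, which is not zero because a generic polygon does not lie on a line. The
  constant tuple spans a copy of \<open>\<xi>\<close>; it rotates the polygon as a whole, which has
  the vertical velocity \<open>\<Sum> l\<^sub>j Re z\<^sub>j = l\<^sub>n \<noteq> 0\<close>. Dividing by the constant tuples amounts to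
  measuring all angular velocities relative to one edge \<open>j\<^sub>0\<close>, and the isomorphism is
  \<open>(t, s) \<mapsto> (t\<^sub>j + s Im z\<^sub>j) - (t\<^sub>j\<^sub>0 + s Im z\<^sub>j\<^sub>0)\<close> for \<open>j \<noteq> j\<^sub>0\<close>
  (\<open>relative_velocity\<close>). Its inverse is given by two successive linear projections
  (\<open>scalar_part\<close>, \<open>closing_part\<close>).

  The larger part of the work is to identify the tangent spaces, which are spaces of derivations,
  with these tuples. A derivation at a point of the quotient is the derivative in the direction of
  some ambient vector, by Hadamard's lemma and bump functions (\<open>derivation_is_directional\<close>);
  applied to the functions that define the polygon space, it shows that the vector is
  the velocity of rotating edges (\<open>derivation_is_velocity\<close>). Conversely, each admissible tuple is the
  velocity of a curve of polygons by the inverse function theorem (\<open>tangent_vector_velocity\<close>), and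
  differentiation along the curve is a derivation.

  Continuity is checked upstairs, on the fibre product with the polygon space, where the choice of
  one of the two representatives is part of the data (\<open>homeomorphic_map_over_open_map\<close>). There
  both the angular velocities of a derivation and the coordinates of a point of \<open>\<xi>\<close> are given
  by formulas that divide only by \<open>\<Sum> l\<^sub>j (Im z\<^sub>j)\<^sup>2\<close> and by the square of the norm of \<open>z\<close> minus its conjugate.
\<close>

section \<open>The algebra of smooth functions\<close>

lemma smooth_onE:
  assumes "smooth_on U f"
  obtains f' where "\<And>x. x \<in> U \<Longrightarrow> (f has_derivative f' x) (at x)"
    and "\<And>v. smooth_on U (\<lambda>x. f' x v)"
  using assms by (cases rule: smooth_on.cases) blast

lemma smooth_on_invariant:
  assumes "P f"
    and step: "\<And>f. P f \<Longrightarrow> \<exists>f'. (\<forall>x\<in>U. (f has_derivative f' x) (at x)) \<and> (\<forall>v. P (\<lambda>x. f' x v))"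
  shows "smooth_on U f"
  using assms(1)
proof (coinduction arbitrary: f)
  case smooth_on
  then obtain f' where "\<forall>x\<in>U. (f has_derivative f' x) (at x)" and "\<forall>v. P (\<lambda>x. f' x v)"
    using step by blast
  then show ?case
    by (intro exI[of _ f] exI[of _ f']) simp
qed

text \<open>
  A product or a composition has a derivative that is only a sum of products, so a direct
  coinduction does not close up. The generated algebra below is stable under directional
  derivatives, which makes it an admissible invariant for the coinduction.
\<close>

inductive generated_by_smooth :: "'a::euclidean_space set \<Rightarrow> ('a \<Rightarrow> real) \<Rightarrow> bool" for U where
  base: "smooth_on U f \<Longrightarrow> generated_by_smooth U f"
| comp: "smooth_on UNIV (\<phi> :: real \<Rightarrow> real) \<Longrightarrow> smooth_on U f \<Longrightarrow>
           generated_by_smooth U (\<lambda>x. \<phi> (f x))"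
| add: "generated_by_smooth U f \<Longrightarrow> generated_by_smooth U g \<Longrightarrow>
          generated_by_smooth U (\<lambda>x. f x + g x)"
| mult: "generated_by_smooth U f \<Longrightarrow> generated_by_smooth U g \<Longrightarrow>
          generated_by_smooth U (\<lambda>x. f x * g x)"

lemma generated_by_smooth_derivative:
  assumes "generated_by_smooth U f"
  shows "\<exists>f'. (\<forall>x\<in>U. (f has_derivative f' x) (at x)) \<and>
              (\<forall>v. generated_by_smooth U (\<lambda>x. f' x v))"
  using assms
proof induction
  case (base f)
  then show ?case
    by (rule smooth_onE) (blast intro: generated_by_smooth.base)
next
  case (comp \<phi> f)
  obtain \<phi>' where \<phi>': "\<And>r. (\<phi> has_derivative \<phi>' r) (at r)" "\<And>v. smooth_on UNIV (\<lambda>r. \<phi>' r v)"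
    by (rule smooth_onE[OF comp(1)]) blast
  obtain f' where f': "\<And>x. x \<in> U \<Longrightarrow> (f has_derivative f' x) (at x)"
      "\<And>v. smooth_on U (\<lambda>x. f' x v)"
    by (rule smooth_onE[OF comp(2)]) blast
  have lin: "\<phi>' r c = \<phi>' r 1 * c" for r c
    using linear_scale[OF has_derivative_linear[OF \<phi>'(1)[of r]], of c 1] by simp
  have "((\<lambda>x. \<phi> (f x)) has_derivative (\<lambda>v. \<phi>' (f x) 1 * f' x v)) (at x)" if "x \<in> U" for x
    using diff_chain_at[OF f'(1)[OF that] \<phi>'(1)] by (simp add: o_def lin[of "f x" "f' x _"])
  moreover have "generated_by_smooth U (\<lambda>x. \<phi>' (f x) 1 * f' x v)" for v
    using f'(2) \<phi>'(2) comp(2) by (intro generated_by_smooth.intros)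
  ultimately show ?case
    by (intro exI[of _ "\<lambda>x v. \<phi>' (f x) 1 * f' x v"]) blast
next
  case (add f g)
  then obtain f' g' where "\<forall>x\<in>U. (f has_derivative f' x) (at x)"
      "\<forall>v. generated_by_smooth U (\<lambda>x. f' x v)" "\<forall>x\<in>U. (g has_derivative g' x) (at x)"
      "\<forall>v. generated_by_smooth U (\<lambda>x. g' x v)"
    by blast
  then show ?case
    by (intro exI[of _ "\<lambda>x v. f' x v + g' x v"])
       (auto intro!: generated_by_smooth.add derivative_eq_intros)
next
  case (mult f g)
  then obtain f' g' where "\<forall>x\<in>U. (f has_derivative f' x) (at x)"
      "\<forall>v. generated_by_smooth U (\<lambda>x. f' x v)" "\<forall>x\<in>U. (g has_derivative g' x) (at x)"
      "\<forall>v. generated_by_smooth U (\<lambda>x. g' x v)"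
    by blast
  with mult.hyps show ?case
    by (intro exI[of _ "\<lambda>x v. f x * g' x v + f' x v * g x"])
       (auto intro!: generated_by_smooth.add generated_by_smooth.mult has_derivative_mult)
qed

lemma smooth_on_generated:
  assumes "generated_by_smooth U f"
  shows "smooth_on U f"
  by (rule smooth_on_invariant[OF assms generated_by_smooth_derivative])

lemma smooth_on_add: "smooth_on U f \<Longrightarrow> smooth_on U g \<Longrightarrow> smooth_on U (\<lambda>x. f x + g x)"
  and smooth_on_mult: "smooth_on U f \<Longrightarrow> smooth_on U g \<Longrightarrow> smooth_on U (\<lambda>x. f x * g x)"
  and smooth_on_compose: "smooth_on UNIV \<phi> \<Longrightarrow> smooth_on U f \<Longrightarrow> smooth_on U (\<lambda>x. \<phi> (f x))"
  using smooth_on_generated[OF generated_by_smooth.add[OF generated_by_smooth.base generated_by_smooth.base]]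
    smooth_on_generated[OF generated_by_smooth.mult[OF generated_by_smooth.base generated_by_smooth.base]]
    smooth_on_generated[OF generated_by_smooth.comp] by blast+

lemma smooth_on_const: "smooth_on U (\<lambda>x. c)"
proof (rule smooth_on_invariant[where P = "\<lambda>f. \<exists>c. f = (\<lambda>x. c)"])
  show "\<exists>c'. (\<lambda>x::'a. c) = (\<lambda>x. c')"
    by blast
next
  fix f :: "'a \<Rightarrow> real" assume "\<exists>c. f = (\<lambda>x. c)"
  then show "\<exists>f'. (\<forall>x\<in>U. (f has_derivative f' x) (at x)) \<and> (\<forall>v. \<exists>c. (\<lambda>x. f' x v) = (\<lambda>x. c))"
    by (intro exI[of _ "\<lambda>x v. 0"]) auto
qed

lemma smooth_on_linear:
  assumes "bounded_linear f"
  shows "smooth_on U f"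
  by (rule smooth_on.intros[of U f "\<lambda>x. f"])
     (auto simp: assms bounded_linear_imp_has_derivative smooth_on_const)

lemma smooth_on_sum:
  assumes "\<And>i. i \<in> I \<Longrightarrow> smooth_on U (f i)"
  shows "smooth_on U (\<lambda>x. \<Sum>i\<in>I. f i x)"
  using assms by (induction I rule: infinite_finite_induct)
    (auto simp: smooth_on_const intro!: smooth_on_add)

lemma smooth_on_cmult: "smooth_on U f \<Longrightarrow> smooth_on U (\<lambda>x. c * f x)"
  by (intro smooth_on_mult smooth_on_const)

lemma smooth_on_subset:
  assumes "smooth_on U f" and "V \<subseteq> U"
  shows "smooth_on V f"
proof (rule smooth_on_invariant[where P = "smooth_on U", OF assms(1)])
  fix f :: "'a \<Rightarrow> real" assume f: "smooth_on U f"
  show "\<exists>f'. (\<forall>x\<in>V. (f has_derivative f' x) (at x)) \<and> (\<forall>v. smooth_on U (\<lambda>x. f' x v))"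
    by (rule smooth_onE[OF f]) (use assms(2) in blast)
qed

lemma smooth_on_compose_linear:
  assumes "smooth_on U f" and "bounded_linear L" and "\<And>x. x \<in> V \<Longrightarrow> L x \<in> U"
  shows "smooth_on V (\<lambda>x. f (L x))"
proof (rule smooth_on_invariant[where P = "\<lambda>g. \<exists>f. smooth_on U f \<and> g = (\<lambda>x. f (L x))"])
  show "\<exists>h. smooth_on U h \<and> (\<lambda>x. f (L x)) = (\<lambda>x. h (L x))"
    using assms(1) by blast
next
  fix g assume "\<exists>f. smooth_on U f \<and> g = (\<lambda>x. f (L x))"
  then obtain f where f: "smooth_on U f" "g = (\<lambda>x. f (L x))"
    by blast
  obtain f' where f': "\<And>x. x \<in> U \<Longrightarrow> (f has_derivative f' x) (at x)"
      "\<And>v. smooth_on U (\<lambda>x. f' x v)"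
    by (rule smooth_onE[OF f(1)]) blast
  have "(g has_derivative (\<lambda>v. f' (L x) (L v))) (at x)" if "x \<in> V" for x
    using diff_chain_at[OF bounded_linear_imp_has_derivative[OF assms(2)] f'(1)[OF assms(3)[OF that]]]
    by (simp add: o_def f(2))
  then show "\<exists>g'. (\<forall>x\<in>V. (g has_derivative g' x) (at x)) \<and>
      (\<forall>v. \<exists>f. smooth_on U f \<and> (\<lambda>x. g' x v) = (\<lambda>x. f (L x)))"
    using f'(2) by (intro exI[of _ "\<lambda>x v. f' (L x) (L v)"]) fast
qed

lemma smooth_on_cong:
  assumes "smooth_on U f" and "open U" and "\<And>x. x \<in> U \<Longrightarrow> f x = g x"
  shows "smooth_on U g"
proof -
  obtain f' where "\<And>x. x \<in> U \<Longrightarrow> (f has_derivative f' x) (at x)" and "\<And>v. smooth_on U (\<lambda>x. f' x v)"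
    by (rule smooth_onE[OF assms(1)]) blast
  then show ?thesis
    using assms(2,3) by (intro smooth_on.intros[of U g f'])
      (auto intro: has_derivative_transform_within_open)
qed

lemma smooth_on_Un:
  assumes "smooth_on U f" and "smooth_on V f" and "open U" and "open V"
  shows "smooth_on (U \<union> V) f"
proof (rule smooth_on_invariant[where P = "\<lambda>f. smooth_on U f \<and> smooth_on V f"])
  fix f :: "'a \<Rightarrow> real" assume f: "smooth_on U f \<and> smooth_on V f"
  obtain f' where f': "\<And>x. x \<in> U \<Longrightarrow> (f has_derivative f' x) (at x)"
      "\<And>v. smooth_on U (\<lambda>x. f' x v)"
    by (rule smooth_onE[OF conjunct1[OF f]]) blast
  obtain f'' where f'': "\<And>x. x \<in> V \<Longrightarrow> (f has_derivative f'' x) (at x)"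
      "\<And>v. smooth_on V (\<lambda>x. f'' x v)"
    by (rule smooth_onE[OF conjunct2[OF f]]) blast
  define D where "D x = frechet_derivative f (at x)" for x
  have D: "f' x = D x" if "x \<in> U" for x
    using f'(1)[OF that] frechet_derivative_at unfolding D_def by blast
  have D': "f'' x = D x" if "x \<in> V" for x
    using f''(1)[OF that] frechet_derivative_at unfolding D_def by blast
  have "smooth_on U (\<lambda>x. D x v) \<and> smooth_on V (\<lambda>x. D x v)" for v
    using smooth_on_cong[OF f'(2) assms(3)] smooth_on_cong[OF f''(2) assms(4)] D D' by auto
  moreover have "(f has_derivative D x) (at x)" if "x \<in> U \<union> V" for x
    using that f' f'' D D' by auto
  ultimately show "\<exists>f'. (\<forall>x\<in>U \<union> V. (f has_derivative f' x) (at x)) \<and>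
      (\<forall>v. smooth_on U (\<lambda>x. f' x v) \<and> smooth_on V (\<lambda>x. f' x v))"
    by blast
qed (use assms in blast)

lemma smooth_on_continuous_on:
  assumes "smooth_on U f"
  shows "continuous_on U f"
  by (rule smooth_onE[OF assms])
     (blast intro: continuous_at_imp_continuous_on has_derivative_continuous)

lemma smooth_on_directional_derivative:
  assumes "smooth_on U f" and "open U"
  shows "smooth_on U (\<lambda>x. frechet_derivative f (at x) v)"
    and "x \<in> U \<Longrightarrow> (f has_derivative frechet_derivative f (at x)) (at x)"
proof -
  obtain f' where f': "\<And>x. x \<in> U \<Longrightarrow> (f has_derivative f' x) (at x)"
      "\<And>v. smooth_on U (\<lambda>x. f' x v)"
    by (rule smooth_onE[OF assms(1)]) blast
  have eq: "f' x = frechet_derivative f (at x)" if "x \<in> U" for x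
    by (rule frechet_derivative_at[OF f'(1)[OF that]])
  show "(f has_derivative frechet_derivative f (at x)) (at x)" if "x \<in> U"
    using f'(1)[OF that] by (simp add: eq[OF that])
  show "smooth_on U (\<lambda>x. frechet_derivative f (at x) v)"
    by (rule smooth_on_cong[OF f'(2)[of v] assms(2)]) (simp add: eq)
qed


section \<open>Bump functions\<close>

text \<open>
  All derivatives of \<open>exp (- 1 / t)\<close> have the form \<open>p (1 / t) exp (- 1 / t)\<close> with a
  polynomial \<open>p\<close>, and \<open>p s exp (- s)\<close> tends to \<open>0\<close> at infinity faster than \<open>1 / s\<close>.
\<close>

definition flat_exp :: "real poly \<Rightarrow> real \<Rightarrow> real" where
  "flat_exp p t = (if t \<le> 0 then 0 else poly p (1 / t) * exp (- (1 / t)))"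

lemma poly_times_exp_minus_tendsto_0:
  "((\<lambda>s. poly p s * exp (- s :: real)) \<longlongrightarrow> 0) at_top"
proof -
  have eq: "poly p s * exp (- s) = (\<Sum>i\<le>degree p. coeff p i * (s ^ i / exp s))" for s
    by (simp add: poly_altdef sum_distrib_right exp_minus field_simps sum_divide_distrib)
  have "((\<lambda>s::real. \<Sum>i\<le>degree p. coeff p i * (s ^ i / exp s)) \<longlongrightarrow> (\<Sum>i\<le>degree p. coeff p i * 0)) at_top"
    by (intro tendsto_intros tendsto_power_div_exp_0)
  then show ?thesis
    by (simp add: eq)
qed

lemma flat_exp_has_real_derivative:
  "(flat_exp p has_real_derivative flat_exp ([:0, 0, 1:] * (p - pderiv p)) t) (at t)"
proof (cases t "0 :: real" rule: linorder_cases)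
  case less
  then show ?thesis
    by (rule_tac has_field_derivative_transform_within_open[where f = "\<lambda>_. 0" and S = "{..<0}"])
       (auto simp: flat_exp_def)
next
  case greater
  have inv: "((\<lambda>t::real. 1 / t) has_real_derivative - (1 / t\<^sup>2)) (at t)"
    using DERIV_inverse[of t] greater by (simp add: inverse_eq_divide power2_eq_square)
  have "((\<lambda>t. poly p (1 / t) * exp (- (1 / t))) has_real_derivative
      poly (pderiv p) (1 / t) * - (1 / t\<^sup>2) * exp (- (1 / t)) +
      exp (- (1 / t)) * - (- (1 / t\<^sup>2)) * poly p (1 / t)) (at t)"
    by (rule DERIV_mult[OF DERIV_chain2[OF poly_DERIV inv]
        DERIV_chain2[OF DERIV_exp DERIV_minus[OF inv]]])
  moreover have "poly (pderiv p) (1 / t) * - (1 / t\<^sup>2) * exp (- (1 / t)) +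
      exp (- (1 / t)) * - (- (1 / t\<^sup>2)) * poly p (1 / t) =
      flat_exp ([:0, 0, 1:] * (p - pderiv p)) t"
    using greater by (simp add: flat_exp_def power2_eq_square algebra_simps)
  ultimately have "((\<lambda>t. poly p (1 / t) * exp (- (1 / t))) has_real_derivative
      flat_exp ([:0, 0, 1:] * (p - pderiv p)) t) (at t)"
    by simp
  then show ?thesis
    using greater
    by (rule_tac has_field_derivative_transform_within_open[where S = "{0<..}"]) (auto simp: flat_exp_def)
next
  case equal
  have "((\<lambda>t. flat_exp p t / t) \<longlongrightarrow> 0) (at_right 0)"
  proof (rule Lim_transform_eventually)
    show "((\<lambda>t. poly (pCons 0 p) (inverse t) * exp (- (inverse t))) \<longlongrightarrow> 0) (at_right 0)"
      by (rule filterlim_compose[OF poly_times_exp_minus_tendsto_0 filterlim_inverse_at_top_right])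
    show "\<forall>\<^sub>F t in at_right 0.
        poly (pCons 0 p) (inverse t) * exp (- (inverse t)) = flat_exp p t / t"
      by (rule eventually_at_rightI[of 0 1]) (auto simp: flat_exp_def field_simps)
  qed
  moreover have "((\<lambda>t. flat_exp p t / t) \<longlongrightarrow> 0) (at_left 0)"
    by (rule tendsto_eventually, rule eventually_at_leftI[of "-1" 0]) (auto simp: flat_exp_def)
  ultimately have "((\<lambda>t. flat_exp p t / t) \<longlongrightarrow> 0) (at 0)"
    by (simp add: filterlim_split_at)
  then show ?thesis
    using equal by (simp add: has_field_derivative_iff flat_exp_def)
qed

lemma smooth_on_flat_exp: "smooth_on UNIV (flat_exp p)"
proof (rule smooth_on_invariant[where P = "\<lambda>f. \<exists>p c. f = (\<lambda>t. c * flat_exp p t)"])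
  show "\<exists>q c. flat_exp p = (\<lambda>t. c * flat_exp q t)"
    by (intro exI[of _ p] exI[of _ 1]) simp
next
  fix f assume "\<exists>p c. f = (\<lambda>t. c * flat_exp p t)"
  then obtain p c where f: "f = (\<lambda>t. c * flat_exp p t)"
    by blast
  define q where "q = [:0, 0, 1:] * (p - pderiv p)"
  have "(f has_derivative (\<lambda>v. (c * v) * flat_exp q t)) (at t)" for t
    using flat_exp_has_real_derivative[of p t]
    unfolding f q_def[symmetric] has_field_derivative_def
    by (auto intro!: derivative_eq_intros simp: mult_ac)
  then show "\<exists>f'. (\<forall>t\<in>UNIV. (f has_derivative f' t) (at t)) \<and>
      (\<forall>v. \<exists>p c. (\<lambda>t. f' t v) = (\<lambda>t. c * flat_exp p t))"
    by (intro exI[of _ "\<lambda>t v. (c * v) * flat_exp q t"]) blast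
qed

lemma smooth_on_dist_square: "smooth_on UNIV (\<lambda>y. (dist y z)\<^sup>2)" for z :: "'a::euclidean_space"
proof -
  have "(dist y z)\<^sup>2 = (\<Sum>b\<in>Basis. (y \<bullet> b - z \<bullet> b) * (y \<bullet> b - z \<bullet> b))" for y
    unfolding dist_norm power2_norm_eq_inner by (subst euclidean_inner) (simp add: inner_diff_left)
  moreover have "smooth_on UNIV (\<lambda>y. y \<bullet> b - z \<bullet> b)" for b :: 'a
    using smooth_on_add[OF smooth_on_linear[OF bounded_linear_inner_left[of b]]
        smooth_on_const[of _ "- (z \<bullet> b)"]] by simp
  ultimately show ?thesis
    by (simp add: smooth_on_sum smooth_on_mult)
qed

lemma smooth_bump_function:
  fixes z :: "'a::euclidean_space"
  assumes "0 < r"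
  obtains \<beta> where "smooth_on UNIV \<beta>" and "\<beta> z = 1" and "\<And>y. r \<le> dist y z \<Longrightarrow> \<beta> y = 0"
proof
  define \<beta> where "\<beta> y = exp (1 / r\<^sup>2) * flat_exp [:1:] (r\<^sup>2 - (dist y z)\<^sup>2)" for y
  have "smooth_on UNIV (\<lambda>y. r\<^sup>2 + (- 1) * (dist y z)\<^sup>2)"
    by (intro smooth_on_add smooth_on_const smooth_on_cmult smooth_on_dist_square)
  then show "smooth_on UNIV \<beta>"
    unfolding \<beta>_def by (intro smooth_on_cmult smooth_on_compose[OF smooth_on_flat_exp]) simp
  show "\<beta> z = 1"
    using assms by (simp add: \<beta>_def flat_exp_def exp_minus)
  show "\<beta> y = 0" if "r \<le> dist y z" for y
    using power_mono[OF that, of 2] assms by (simp add: \<beta>_def flat_exp_def)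
qed

text \<open>Multiplying with a bump function extends local functions smoothly by zero.\<close>

lemma smooth_on_extend_by_zero:
  assumes "smooth_on UNIV \<beta>" and "\<And>y. r \<le> dist y z \<Longrightarrow> \<beta> y = 0" and "r < R"
    and "smooth_on (ball z R) g"
  shows "smooth_on UNIV (\<lambda>y. if y \<in> ball z R then \<beta> y * g y else 0)" (is "smooth_on UNIV ?f")
proof -
  have "smooth_on (ball z R) (\<lambda>y. \<beta> y * g y)"
    using assms by (intro smooth_on_mult smooth_on_subset[OF assms(1)]) auto
  then have "smooth_on (ball z R) ?f"
    by (rule smooth_on_cong) auto
  moreover have "smooth_on (- cball z r) ?f"
    by (rule smooth_on_cong[OF smooth_on_const[of _ 0]]) (auto simp: assms(2) dist_commute)
  moreover have "ball z R \<union> - cball z r = UNIV"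
    using assms(3) by auto
  ultimately show ?thesis
    using smooth_on_Un by (metis closed_cball open_Compl open_ball)
qed



section \<open>Taylor expansion with smooth coefficients\<close>

text \<open>
  Differentiation under the integral sign produces another integral of the same kind, with
  one more factor \<open>s\<close> and a directional derivative of \<open>\<psi>\<close>; hence the coinduction closes up.
\<close>

lemma smooth_on_ray_integral:
  fixes \<psi> :: "'a::euclidean_space \<Rightarrow> real"
  assumes "smooth_on (ball z r) \<psi>"
  shows "smooth_on (ball z r) (\<lambda>y. integral (cbox 0 1) (\<lambda>s. s ^ k * \<psi> (z + s *\<^sub>R (y - z))))"
proof (rule smooth_on_invariant[where P = "\<lambda>\<phi>. \<exists>k \<psi>. smooth_on (ball z r) \<psi> \<and>
    \<phi> = (\<lambda>y. integral (cbox 0 1) (\<lambda>s. s ^ k * \<psi> (z + s *\<^sub>R (y - z))))"])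
  show "\<exists>j \<omega>. smooth_on (ball z r) \<omega> \<and>
      (\<lambda>y. integral (cbox 0 1) (\<lambda>s. s ^ k * \<psi> (z + s *\<^sub>R (y - z)))) =
      (\<lambda>y. integral (cbox 0 1) (\<lambda>s. s ^ j * \<omega> (z + s *\<^sub>R (y - z))))"
    using assms by blast
next
  fix \<phi>
  assume "\<exists>k \<psi>. smooth_on (ball z r) \<psi> \<and>
    \<phi> = (\<lambda>y. integral (cbox 0 1) (\<lambda>s. s ^ k * \<psi> (z + s *\<^sub>R (y - z))))"
  then obtain k \<psi> where \<psi>: "smooth_on (ball z r) \<psi>"
    and \<phi>: "\<phi> = (\<lambda>y. integral (cbox 0 1) (\<lambda>s. s ^ k * \<psi> (z + s *\<^sub>R (y - z))))"
    by blast
  obtain \<psi>' where \<psi>': "\<And>x. x \<in> ball z r \<Longrightarrow> (\<psi> has_derivative \<psi>' x) (at x)"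
      "\<And>v. smooth_on (ball z r) (\<lambda>x. \<psi>' x v)"
    by (rule smooth_onE[OF \<psi>]) blast
  define ray where "ray y s = z + s *\<^sub>R (y - z)" for y s
  have ray: "ray y s \<in> ball z r" if "y \<in> ball z r" "s \<in> cbox 0 1" for y s
  proof -
    have "s * norm (y - z) \<le> 1 * norm (y - z)"
      using that(2) by (intro mult_right_mono) auto
    then show ?thesis
      using that by (simp add: ray_def dist_norm norm_minus_commute)
  qed
  have cont_ray: "continuous_on S (\<lambda>p. ray (fst p) (snd p))" for S
    unfolding ray_def by (intro continuous_intros)
  define L where "L y s = Blinfun (\<lambda>v. s ^ Suc k * \<psi>' (ray y s) v)" for y s
  have L: "blinfun_apply (L y s) = (\<lambda>v. s ^ Suc k * \<psi>' (ray y s) v)"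
    if "y \<in> ball z r" "s \<in> cbox 0 1" for y s
    unfolding L_def using \<psi>'(1)[OF ray[OF that]]
    by (intro bounded_linear_Blinfun_apply bounded_linear_mult_const
        bounded_linear_const_mult has_derivative_bounded_linear)
  have cont_L: "continuous_on (ball z r \<times> cbox 0 1) (\<lambda>(y, s). L y s)"
  proof (rule continuous_on_blinfun_componentwise)
    fix b :: 'a
    have "continuous_on (ball z r \<times> cbox 0 1)
        (\<lambda>p. snd p ^ Suc k * \<psi>' (ray (fst p) (snd p)) b)"
      using ray by (intro continuous_intros
          continuous_on_compose2[OF smooth_on_continuous_on[OF \<psi>'(2)] cont_ray]) auto
    then show "continuous_on (ball z r \<times> cbox 0 1) (\<lambda>p. blinfun_apply (case p of (y, s) \<Rightarrow> L y s) b)"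
      by (rule continuous_on_eq) (auto simp: L)
  qed
  have deriv: "(\<phi> has_derivative integral (cbox 0 1) (L y)) (at y)" if y: "y \<in> ball z r" for y
  proof -
    have "((\<lambda>y. integral (cbox 0 1) (\<lambda>s. s ^ k * \<psi> (ray y s))) has_derivative
        integral (cbox 0 1) (L y)) (at y within ball z r)"
    proof (rule leibniz_rule[where fx = L and f = "\<lambda>y s. s ^ k * \<psi> (ray y s)", OF _ _ cont_L y convex_ball])
      fix x s assume xs: "x \<in> ball z r" "s \<in> cbox (0::real) 1"
      have "((\<lambda>x. ray x s) has_derivative (\<lambda>v. s *\<^sub>R v)) (at x)"
        using has_derivative_add[OF has_derivative_const has_derivative_scaleR_right[OF
            has_derivative_diff[OF has_derivative_ident has_derivative_const]]]
        by (simp add: ray_def)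
      from diff_chain_at[OF this \<psi>'(1)[OF ray[OF xs]]]
      have "((\<lambda>x. \<psi> (ray x s)) has_derivative (\<lambda>v. \<psi>' (ray x s) (s *\<^sub>R v))) (at x)"
        by (simp add: o_def)
      moreover have "\<psi>' (ray x s) (s *\<^sub>R v) = s * \<psi>' (ray x s) v" for v
        using linear_scale[OF has_derivative_linear[OF \<psi>'(1)[OF ray[OF xs]]]] by simp
      ultimately have "((\<lambda>x. s ^ k * \<psi> (ray x s)) has_derivative
          (\<lambda>v. s ^ k * (s * \<psi>' (ray x s) v))) (at x)"
        by (intro has_derivative_mult_right) simp
      then show "((\<lambda>x. s ^ k * \<psi> (ray x s)) has_derivative blinfun_apply (L x s))
          (at x within ball z r)"
        using L[OF xs] by (simp add: has_derivative_at_withinI mult_ac)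
    next
      fix x assume x: "x \<in> ball z r"
      show "(\<lambda>s. s ^ k * \<psi> (ray x s)) integrable_on cbox 0 1"
        using ray[OF x] unfolding ray_def
        by (intro integrable_continuous continuous_intros
            continuous_on_compose2[OF smooth_on_continuous_on[OF \<psi>]]) auto
    qed
    then show ?thesis
      by (simp add: \<phi> ray_def at_within_open[OF y open_ball])
  qed
  have apply_L: "blinfun_apply (integral (cbox 0 1) (L y)) v =
      integral (cbox 0 1) (\<lambda>s. s ^ Suc k * \<psi>' (ray y s) v)" if y: "y \<in> ball z r" for y v
  proof -
    have "continuous_on (cbox 0 1) (\<lambda>s. (\<lambda>(y, s). L y s) (y, s))"
      by (rule continuous_on_compose2[OF cont_L]) (use y in \<open>auto intro!: continuous_intros\<close>)
    then have "L y integrable_on cbox 0 1"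
      by (intro integrable_continuous) simp
    then show ?thesis
      using L[OF y] by (auto simp: blinfun_apply_integral intro!: integral_cong)
  qed
  show "\<exists>\<phi>'. (\<forall>y\<in>ball z r. (\<phi> has_derivative \<phi>' y) (at y)) \<and>
      (\<forall>v. \<exists>k \<psi>. smooth_on (ball z r) \<psi> \<and>
        (\<lambda>y. \<phi>' y v) = (\<lambda>y. integral (cbox 0 1) (\<lambda>s. s ^ k * \<psi> (z + s *\<^sub>R (y - z)))))"
  proof (intro exI[of _ "\<lambda>y v. integral (cbox 0 1) (\<lambda>s. s ^ Suc k * \<psi>' (ray y s) v)"]
      conjI ballI allI)
    fix y assume y: "y \<in> ball z r"
    have "blinfun_apply (integral (cbox 0 1) (L y)) =
        (\<lambda>v. integral (cbox 0 1) (\<lambda>s. s ^ Suc k * \<psi>' (ray y s) v))"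
      using apply_L[OF y] by blast
    then show "(\<phi> has_derivative
        (\<lambda>v. integral (cbox 0 1) (\<lambda>s. s ^ Suc k * \<psi>' (ray y s) v))) (at y)"
      using deriv[OF y] by simp
  next
    fix v
    show "\<exists>j \<omega>. smooth_on (ball z r) \<omega> \<and>
        (\<lambda>y. integral (cbox 0 1) (\<lambda>s. s ^ Suc k * \<psi>' (ray y s) v)) =
        (\<lambda>y. integral (cbox 0 1) (\<lambda>s. s ^ j * \<omega> (z + s *\<^sub>R (y - z))))"
      using \<psi>'(2)[of v]
      by (intro exI[of _ "Suc k"] exI[of _ "\<lambda>x. \<psi>' x v"]) (simp add: ray_def)
  qed
qed

text \<open>
  Hadamard's lemma: integrate the derivative of \<open>h\<close> along the segment from \<open>z\<close> to \<open>y\<close>.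
\<close>

lemma smooth_on_first_order_expansion:
  fixes z :: "'a::euclidean_space"
  assumes h: "smooth_on (ball z r) h" and "0 < r"
  obtains g where "\<And>b. smooth_on (ball z r) (g b)"
    and "\<And>b. g b z = frechet_derivative h (at z) b"
    and "\<And>y. y \<in> ball z r \<Longrightarrow> h y = h z + (\<Sum>b\<in>Basis. ((y - z) \<bullet> b) * g b y)"
proof
  define h' where "h' x = frechet_derivative h (at x)" for x
  define g where "g b y = integral (cbox 0 1) (\<lambda>s. s ^ 0 * h' (z + s *\<^sub>R (y - z)) b)" for b y
  note h' = smooth_on_directional_derivative[OF h open_ball, folded h'_def]
  show "smooth_on (ball z r) (g b)" for b
    unfolding g_def by (rule smooth_on_ray_integral[OF h'(1)])
  show "g b z = frechet_derivative h (at z) b" for b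
    by (simp add: g_def h'_def)
  show "h y = h z + (\<Sum>b\<in>Basis. ((y - z) \<bullet> b) * g b y)" if y: "y \<in> ball z r" for y
  proof -
    have ray: "z + s *\<^sub>R (y - z) \<in> ball z r" if "s \<in> cbox 0 1" for s
    proof -
      have "s * norm (y - z) \<le> 1 * norm (y - z)"
        using that by (intro mult_right_mono) auto
      then show ?thesis
        using that y by (simp add: dist_norm norm_minus_commute)
    qed
    have expand: "h' x (y - z) = (\<Sum>b\<in>Basis. ((y - z) \<bullet> b) * h' x b)" if "x \<in> ball z r" for x
    proof -
      have lin: "linear (h' x)"
        using has_derivative_linear[OF h'(2)[OF that]] .
      have "h' x (y - z) = h' x (\<Sum>b\<in>Basis. ((y - z) \<bullet> b) *\<^sub>R b)"
        by (simp only: euclidean_representation)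
      also have "\<dots> = (\<Sum>b\<in>Basis. ((y - z) \<bullet> b) * h' x b)"
        by (simp add: linear_sum[OF lin] linear_scale[OF lin])
      finally show ?thesis .
    qed
    have int: "(\<lambda>s. h' (z + s *\<^sub>R (y - z)) b) integrable_on {0..1}" for b
      using ray by (intro integrable_continuous_interval continuous_intros
          continuous_on_compose2[OF smooth_on_continuous_on[OF h'(1)]]) auto
    have "((\<lambda>s. h' (z + s *\<^sub>R (y - z)) (y - z)) has_integral
        h (z + 1 *\<^sub>R (y - z)) - h (z + 0 *\<^sub>R (y - z))) {0..1}"
    proof (rule fundamental_theorem_of_calculus)
      fix s :: real assume s: "s \<in> {0..1}"
      have "((\<lambda>s. z + s *\<^sub>R (y - z)) has_derivative (\<lambda>c. c *\<^sub>R (y - z))) (at s)"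
        using has_derivative_add[OF has_derivative_const has_derivative_scaleR_left[OF
            has_derivative_ident]] by simp
      from diff_chain_at[OF this h'(2)[OF ray]] s
      have "((\<lambda>s. h (z + s *\<^sub>R (y - z))) has_derivative
          (\<lambda>c. h' (z + s *\<^sub>R (y - z)) (c *\<^sub>R (y - z)))) (at s)"
        by (simp add: o_def)
      moreover have "h' (z + s *\<^sub>R (y - z)) (c *\<^sub>R (y - z)) = c *\<^sub>R h' (z + s *\<^sub>R (y - z)) (y - z)" for c
        using s by (intro linear_scale has_derivative_linear[OF h'(2)[OF ray]]) auto
      ultimately show "((\<lambda>s. h (z + s *\<^sub>R (y - z))) has_vector_derivative
          h' (z + s *\<^sub>R (y - z)) (y - z)) (at s within {0..1})"
        unfolding has_vector_derivative_def by (simp add: has_derivative_at_withinI)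
    qed simp
    then have "h y - h z = integral {0..1} (\<lambda>s. h' (z + s *\<^sub>R (y - z)) (y - z))"
      by (simp add: integral_unique)
    also have "\<dots> = integral {0..1} (\<lambda>s. \<Sum>b\<in>Basis. ((y - z) \<bullet> b) * h' (z + s *\<^sub>R (y - z)) b)"
      using ray by (intro integral_cong expand) auto
    also have "\<dots> = (\<Sum>b\<in>Basis. ((y - z) \<bullet> b) * g b y)"
      using int by (subst integral_sum) (auto simp: g_def intro: integrable_on_mult_right)
    finally show ?thesis
      by simp
  qed
qed


section \<open>Curves in a level set\<close>

text \<open>
  With a linear right inverse \<open>P\<close> of the derivative of \<open>f\<close> at \<open>x\<close>, the map
  \<open>(s, c) \<mapsto> (s, f (x + s v + P c))\<close> has the identity as its derivative at the origin, and the
  curve is read off from its local inverse.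
\<close>

lemma tangent_curve_in_level_set:
  fixes f :: "'a::euclidean_space \<Rightarrow> 'b::euclidean_space"
  assumes f': "\<And>x. (f has_derivative blinfun_apply (f' x)) (at x)"
    and cont: "continuous_on UNIV f'"
    and P: "bounded_linear P" "\<And>c. blinfun_apply (f' x) (P c) = c"
    and v: "blinfun_apply (f' x) v = 0"
  obtains \<gamma> where "\<gamma> 0 = x" and "(\<gamma> has_vector_derivative v) (at 0)"
    and "\<forall>\<^sub>F s in at (0::real). f (\<gamma> s) = f x"
proof -
  define A :: "real \<times> 'b \<Rightarrow> 'a" where "A p = fst p *\<^sub>R v + P (snd p)" for p
  have A: "bounded_linear A"
    unfolding A_def
    by (intro bounded_linear_add bounded_linear_compose[OF P(1)] bounded_linear_snd
        bounded_linear_compose[OF bounded_linear_scaleR_left bounded_linear_fst])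
  define \<Phi> where "\<Phi> p = (fst p, f (x + A p))" for p
  define \<Phi>' where "\<Phi>' p = Blinfun (\<lambda>q. (fst q, blinfun_apply (f' (x + A p)) (A q)))" for p
  have apply_\<Phi>': "blinfun_apply (\<Phi>' p) = (\<lambda>q. (fst q, blinfun_apply (f' (x + A p)) (A q)))" for p
    unfolding \<Phi>'_def
    by (intro bounded_linear_Blinfun_apply bounded_linear_Pair bounded_linear_fst
        bounded_linear_compose[OF blinfun.bounded_linear_right A])
  have d: "(\<Phi> has_derivative blinfun_apply (\<Phi>' p)) (at p)" for p
  proof -
    have "((\<lambda>p. x + A p) has_derivative A) (at p)"
      using bounded_linear_imp_has_derivative[OF A] by (auto intro!: derivative_eq_intros)
    from diff_chain_at[OF this f']
    have "((\<lambda>p. f (x + A p)) has_derivative (\<lambda>q. blinfun_apply (f' (x + A p)) (A q))) (at p)"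
      by (simp add: o_def)
    then show ?thesis
      unfolding \<Phi>_def apply_\<Phi>' by (intro has_derivative_Pair has_derivative_fst has_derivative_ident)
  qed
  have c: "continuous_on UNIV \<Phi>'"
  proof (rule continuous_on_blinfun_componentwise)
    fix q :: "real \<times> 'b"
    have "continuous_on UNIV A"
      using A linear_continuous_on by blast
    then show "continuous_on UNIV (\<lambda>p. blinfun_apply (\<Phi>' p) q)"
      unfolding apply_\<Phi>'
      by (intro continuous_intros continuous_on_compose2[OF cont]) auto
  qed
  have i: "id_blinfun o\<^sub>L \<Phi>' 0 = id_blinfun"
    by (rule blinfun_eqI) (simp add: apply_\<Phi>' A_def blinfun.bilinear_simps v P(2)
        linear_0[OF bounded_linear.linear[OF P(1)]])
  obtain U' V g g' where "open V" and V: "\<Phi> 0 \<in> V" and hom: "homeomorphism U' V \<Phi> g"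
    and U': "0 \<in> U'"
    and g': "\<And>y. y \<in> V \<Longrightarrow> (g has_derivative g' y) (at y)"
      "\<And>y. y \<in> V \<Longrightarrow> g' y = inv (blinfun_apply (\<Phi>' (g y)))"
    by (rule inverse_function_theorem[OF open_UNIV d c UNIV_I i]) blast
  have A0: "A 0 = 0"
    by (simp add: A_def linear_0[OF bounded_linear.linear[OF P(1)]])
  have \<Phi>0: "\<Phi> 0 = (0, f x)"
    by (simp add: \<Phi>_def A0)
  have g0: "g (0, f x) = 0"
    using hom U' \<Phi>0 by (metis homeomorphism_apply1)
  have "blinfun_apply (\<Phi>' 0) = id"
    by (auto simp: apply_\<Phi>' A0) (auto simp: A_def blinfun.bilinear_simps v P(2))
  then have dg: "(g has_derivative id) (at (0, f x))"
    using g'(1)[OF V] g'(2)[OF V] \<Phi>0 g0 by simp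
  define \<gamma> where "\<gamma> s = x + A (g (s, f x))" for s
  have "((\<lambda>s. (s, f x)) has_derivative (\<lambda>c. (c, 0))) (at (0::real))"
    by (auto intro!: derivative_eq_intros)
  from diff_chain_at[OF this dg]
  have "((\<lambda>s. g (s, f x)) has_derivative (\<lambda>c. (c, 0))) (at 0)"
    by (simp add: o_def)
  from diff_chain_at[OF this bounded_linear_imp_has_derivative[OF A]]
  have "((\<lambda>s. A (g (s, f x))) has_derivative (\<lambda>c. A (c, 0))) (at 0)"
    by (simp add: o_def)
  from has_derivative_add[OF has_derivative_const this]
  have "(\<gamma> has_derivative (\<lambda>c. c *\<^sub>R v)) (at 0)"
    unfolding \<gamma>_def by (simp add: A_def linear_0[OF bounded_linear.linear[OF P(1)]])
  then have "(\<gamma> has_vector_derivative v) (at 0)"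
    by (simp add: has_vector_derivative_def)
  moreover have "\<forall>\<^sub>F s in at (0::real). f (\<gamma> s) = f x"
  proof -
    have "((\<lambda>s. (s, f x)) \<longlongrightarrow> (0, f x)) (at (0::real))"
      by (intro tendsto_intros)
    then have "\<forall>\<^sub>F s in at (0::real). (s, f x) \<in> V"
      using \<open>open V\<close> V \<Phi>0 by (simp add: topological_tendstoD)
    then show ?thesis
    proof (rule eventually_mono)
      fix s assume "(s, f x) \<in> V"
      then have "\<Phi> (g (s, f x)) = (s, f x)"
        using hom by (metis homeomorphism_apply2)
      then show "f (\<gamma> s) = f x"
        by (simp add: \<Phi>_def \<gamma>_def)
    qed
  qed
  moreover have "\<gamma> 0 = x"
    by (simp add: \<gamma>_def g0 A0)
  ultimately show ?thesis
    using that by blast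
qed



section \<open>Derivations of the smooth functions on a quotient\<close>

definition smooth_extension :: "'a::euclidean_space set \<Rightarrow> ('a \<Rightarrow> real) \<Rightarrow> 'a \<Rightarrow> ('a \<Rightarrow> real) \<Rightarrow> bool" where
  "smooth_extension S f x h \<longleftrightarrow> (\<exists>U. open U \<and> x \<in> U \<and> smooth_on U h \<and> (\<forall>y\<in>S \<inter> U. f y = h y))"

definition tangent_vector :: "'a::euclidean_space set \<Rightarrow> 'a \<Rightarrow> 'a \<Rightarrow> bool" where
  "tangent_vector S x v \<longleftrightarrow> (\<exists>\<gamma>. \<gamma> 0 = x \<and> (\<gamma> has_vector_derivative v) (at 0) \<and>
     (\<forall>\<^sub>F s in at (0::real). \<gamma> s \<in> S))"

definition velocity_derivative :: "'a::euclidean_space set \<Rightarrow> ('a \<Rightarrow> real) \<Rightarrow> 'a \<Rightarrow> 'a \<Rightarrow> real" where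
  "velocity_derivative S f x v = frechet_derivative (SOME h. smooth_extension S f x h) (at x) v"

lemma has_derivative_smooth_extension:
  assumes "smooth_extension S f x h"
  shows "(h has_derivative frechet_derivative h (at x)) (at x)"
  using assms smooth_on_directional_derivative(2) unfolding smooth_extension_def by blast

lemma DERIV_smooth_extension_along_curve:
  assumes h: "smooth_extension S f (\<gamma> 0) h" and "\<gamma> 0 \<in> S"
    and \<gamma>: "(\<gamma> has_vector_derivative v) (at 0)" "\<forall>\<^sub>F s in at (0::real). \<gamma> s \<in> S"
  shows "((\<lambda>s. f (\<gamma> s)) has_real_derivative frechet_derivative h (at (\<gamma> 0)) v) (at 0)"
proof -
  obtain U where U: "open U" "\<gamma> 0 \<in> U" "\<And>y. y \<in> S \<Longrightarrow> y \<in> U \<Longrightarrow> f y = h y"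
    using h unfolding smooth_extension_def by blast
  note h' = has_derivative_smooth_extension[OF h]
  have "(\<gamma> has_derivative (\<lambda>c. c *\<^sub>R v)) (at 0)"
    using \<gamma>(1) by (simp add: has_vector_derivative_def)
  from diff_chain_at[OF this h']
  have "((\<lambda>s. h (\<gamma> s)) has_derivative (\<lambda>c. frechet_derivative h (at (\<gamma> 0)) (c *\<^sub>R v))) (at 0)"
    by (simp add: o_def)
  moreover have "(\<lambda>c. frechet_derivative h (at (\<gamma> 0)) (c *\<^sub>R v)) = (*) (frechet_derivative h (at (\<gamma> 0)) v)"
    using linear_scale[OF has_derivative_linear[OF h']] by (auto simp: fun_eq_iff mult.commute)
  ultimately have "((\<lambda>s. h (\<gamma> s)) has_real_derivative frechet_derivative h (at (\<gamma> 0)) v) (at 0)"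
    by (simp add: has_field_derivative_def)
  moreover have "\<forall>\<^sub>F s in at 0. h (\<gamma> s) = f (\<gamma> s)"
  proof -
    have "(\<gamma> \<longlongrightarrow> \<gamma> 0) (at 0)"
      using has_vector_derivative_continuous[OF \<gamma>(1)] by (simp add: continuous_at)
    then have "\<forall>\<^sub>F s in at 0. \<gamma> s \<in> U"
      using U topological_tendstoD by blast
    with \<gamma>(2) show ?thesis
      by eventually_elim (use U(3) in auto)
  qed
  moreover have "h (\<gamma> 0) = f (\<gamma> 0)"
    using U assms(2) by simp
  ultimately show ?thesis
    unfolding has_field_derivative_def by (rule has_derivative_transform_eventually) simp
qed

text \<open>
  All smooth extensions of \<open>f\<close> have the same derivative along a vector that is the velocity
  of a curve in \<open>S\<close>, since it is the derivative of \<open>f\<close> along the curve.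
\<close>

lemma velocity_derivative_eq:
  assumes "smooth_extension S f x h" and "x \<in> S" and "tangent_vector S x v"
  shows "velocity_derivative S f x v = frechet_derivative h (at x) v"
proof -
  obtain \<gamma> where \<gamma>: "\<gamma> 0 = x" "(\<gamma> has_vector_derivative v) (at 0)" "\<forall>\<^sub>F s in at (0::real). \<gamma> s \<in> S"
    using assms(3) unfolding tangent_vector_def by blast
  define k where "k = (SOME h. smooth_extension S f x h)"
  have "smooth_extension S f x k"
    unfolding k_def by (rule someI[of "smooth_extension S f x", OF assms(1)])
  then have "((\<lambda>s. f (\<gamma> s)) has_real_derivative frechet_derivative k (at x) v) (at 0)"
    using DERIV_smooth_extension_along_curve[of S f \<gamma> k v] \<gamma> assms(2) by simp
  moreover have "((\<lambda>s. f (\<gamma> s)) has_real_derivative frechet_derivative h (at x) v) (at 0)"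
    using DERIV_smooth_extension_along_curve[of S f \<gamma> h v] \<gamma> assms by simp
  ultimately show ?thesis
    unfolding velocity_derivative_def k_def using DERIV_unique by blast
qed

lemma DERIV_along_curve:
  assumes "smooth_extension S f x h" and "x \<in> S"
    and "\<gamma> 0 = x" "(\<gamma> has_vector_derivative v) (at 0)" "\<forall>\<^sub>F s in at (0::real). \<gamma> s \<in> S"
  shows "((\<lambda>s. f (\<gamma> s)) has_real_derivative velocity_derivative S f x v) (at 0)"
proof -
  have "tangent_vector S x v"
    using assms(3-5) unfolding tangent_vector_def by blast
  then show ?thesis
    using DERIV_smooth_extension_along_curve[of S f \<gamma> h v] velocity_derivative_eq[of S f x h v] assms
    by simp
qed

lemma continuous_on_velocity_derivative:
  fixes S :: "'a::euclidean_space set"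
  assumes "\<And>x. x \<in> S \<Longrightarrow> \<exists>h. smooth_extension S f x h"
  shows "continuous_on {(x, v). x \<in> S \<and> tangent_vector S x v} (\<lambda>(x, v). velocity_derivative S f x v)"
proof (rule continuous_on_eq_continuous_within[THEN iffD2], rule ballI)
  let ?T = "{(x, v). x \<in> S \<and> tangent_vector S x v}"
  fix p assume p: "p \<in> ?T"
  then obtain h U where U: "open U" "fst p \<in> U" "smooth_on U h" "\<And>y. y \<in> S \<Longrightarrow> y \<in> U \<Longrightarrow> f y = h y"
    using assms[of "fst p"] unfolding smooth_extension_def by fastforce
  have ext: "smooth_extension S f x h" if "x \<in> U" for x
    using U that unfolding smooth_extension_def by blast
  have eq: "velocity_derivative S f x v = (\<Sum>b\<in>Basis. (v \<bullet> b) * frechet_derivative h (at x) b)"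
    if "(x, v) \<in> ?T" "x \<in> U" for x v
  proof -
    have lin: "linear (frechet_derivative h (at x))"
      using has_derivative_linear[OF has_derivative_smooth_extension[OF ext[OF that(2)]]] .
    have "velocity_derivative S f x v = frechet_derivative h (at x) (\<Sum>b\<in>Basis. (v \<bullet> b) *\<^sub>R b)"
      using velocity_derivative_eq[OF ext[OF that(2)]] that(1) by (simp add: euclidean_representation)
    then show ?thesis
      by (simp add: linear_sum[OF lin] linear_scale[OF lin])
  qed
  have "continuous_on (U \<times> UNIV) (\<lambda>p. \<Sum>b\<in>Basis. (snd p \<bullet> b) * frechet_derivative h (at (fst p)) b)"
    by (intro continuous_intros continuous_on_compose2[OF smooth_on_continuous_on[OF
        smooth_on_directional_derivative(1)[OF U(3,1)]] continuous_on_fst[OF continuous_on_id]]) auto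
  then have "isCont (\<lambda>p. \<Sum>b\<in>Basis. (snd p \<bullet> b) * frechet_derivative h (at (fst p)) b) p"
    unfolding continuous_on_eq_continuous_at[OF open_Times[OF U(1) open_UNIV]]
    using U(2) by (elim ballE) (auto simp: mem_Times_iff)
  then have "continuous (at p within ?T)
      (\<lambda>p. \<Sum>b\<in>Basis. (snd p \<bullet> b) * frechet_derivative h (at (fst p)) b)"
    by (rule continuous_at_imp_continuous_at_within)
  then show "continuous (at p within ?T) (\<lambda>(x, v). velocity_derivative S f x v)"
  proof (rule continuous_transform_within_openin)
    show "openin (top_of_set ?T) (?T \<inter> (U \<times> UNIV))"
      using U(1) by (intro openin_open_Int open_Times) auto
    show "p \<in> ?T \<inter> (U \<times> UNIV)"
      using p U(2) by (auto simp: mem_Times_iff)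
    show "(\<Sum>b\<in>Basis. (snd q \<bullet> b) * frechet_derivative h (at (fst q)) b) =
        (\<lambda>(x, v). velocity_derivative S f x v) q" if "q \<in> ?T \<inter> (U \<times> UNIV)" for q
      using that eq[of "fst q" "snd q"] by (cases q) auto
  qed
qed

locale free_linear_involution =
  fixes S :: "'a::euclidean_space set" and \<sigma> :: "'a \<Rightarrow> 'a"
  assumes bounded_linear_\<sigma>: "bounded_linear \<sigma>"
    and \<sigma>_\<sigma> [simp]: "\<sigma> (\<sigma> x) = x"
    and \<sigma>_in [simp]: "x \<in> S \<Longrightarrow> \<sigma> x \<in> S"
    and \<sigma>_free: "x \<in> S \<Longrightarrow> \<sigma> x \<noteq> x"
begin

abbreviation "quotient_space \<equiv> quotient_topology (top_of_set S) (orbit \<sigma>)"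

abbreviation "smooth_algebra \<equiv> quotient_smooth_functions S \<sigma>"

lemma topspace_quotient_space: "topspace quotient_space = orbit \<sigma> ` S"
  by (simp add: topspace_quotient_topology)

lemma orbit_\<sigma> [simp]: "orbit \<sigma> (\<sigma> x) = orbit \<sigma> x"
  by (auto simp: orbit_def)

lemma orbit_eq_iff: "orbit \<sigma> x = orbit \<sigma> y \<longleftrightarrow> y = x \<or> y = \<sigma> x"
  by (auto simp: orbit_def doubleton_eq_iff)

lemma mem_smooth_algebra_iff:
  "f \<in> smooth_algebra \<longleftrightarrow> f \<in> extensional (orbit \<sigma> ` S) \<and>
     (\<forall>x\<in>S. \<exists>h. smooth_extension S (\<lambda>y. f (orbit \<sigma> y)) x h)"
  by (simp add: quotient_smooth_functions_def smooth_functions_def smooth_extension_def) blast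

lemma smooth_algebra_combination:
  assumes "f \<in> smooth_algebra" and "g \<in> smooth_algebra"
    and "\<And>U (h :: 'a \<Rightarrow> real) k. smooth_on U h \<Longrightarrow> smooth_on U k \<Longrightarrow> smooth_on U (\<lambda>x. F (h x) (k x))"
  shows "(\<lambda>y\<in>orbit \<sigma> ` S. F (f y) (g y)) \<in> smooth_algebra"
  unfolding mem_smooth_algebra_iff
proof (intro conjI ballI)
  fix x assume x: "x \<in> S"
  obtain h k U V where U: "open U" "x \<in> U" "smooth_on U h" "\<And>y. y \<in> S \<Longrightarrow> y \<in> U \<Longrightarrow> f (orbit \<sigma> y) = h y"
    and V: "open V" "x \<in> V" "smooth_on V k" "\<And>y. y \<in> S \<Longrightarrow> y \<in> V \<Longrightarrow> g (orbit \<sigma> y) = k y"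
    using assms(1,2) x unfolding mem_smooth_algebra_iff smooth_extension_def by (metis IntI)
  have "smooth_on (U \<inter> V) (\<lambda>x. F (h x) (k x))"
    by (intro assms(3) smooth_on_subset[OF U(3)] smooth_on_subset[OF V(3)]) auto
  then show "\<exists>h. smooth_extension S (\<lambda>y. (\<lambda>y\<in>orbit \<sigma> ` S. F (f y) (g y)) (orbit \<sigma> y)) x h"
    unfolding smooth_extension_def using U V
    by (intro exI[of _ "\<lambda>x. F (h x) (k x)"] exI[of _ "U \<inter> V"]) auto
qed simp

lemma smooth_algebra_linear_combination:
  assumes "f \<in> smooth_algebra" and "g \<in> smooth_algebra"
  shows "(\<lambda>y\<in>orbit \<sigma> ` S. a * f y + b * g y) \<in> smooth_algebra"
  using assms by (rule smooth_algebra_combination) (intro smooth_on_add smooth_on_cmult)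

lemma smooth_algebra_mult:
  assumes "f \<in> smooth_algebra" and "g \<in> smooth_algebra"
  shows "(\<lambda>y\<in>orbit \<sigma> ` S. f y * g y) \<in> smooth_algebra"
  using assms by (rule smooth_algebra_combination) (rule smooth_on_mult)

definition descend :: "('a \<Rightarrow> real) \<Rightarrow> 'a set \<Rightarrow> real" where
  "descend g = (\<lambda>b\<in>orbit \<sigma> ` S. g (SOME x. x \<in> b))"

lemma descend_orbit:
  assumes "x \<in> S" and "\<And>x. x \<in> S \<Longrightarrow> g (\<sigma> x) = g x"
  shows "descend g (orbit \<sigma> x) = g x"
proof -
  have "(SOME y. y \<in> orbit \<sigma> x) \<in> orbit \<sigma> x"
    by (rule someI[of _ x]) (simp add: orbit_def)
  then show ?thesis
    using assms by (auto simp: descend_def orbit_def)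
qed

lemma descend_in_smooth_algebra:
  assumes "smooth_on UNIV g" and "\<And>x. x \<in> S \<Longrightarrow> g (\<sigma> x) = g x"
  shows "descend g \<in> smooth_algebra" and "smooth_extension S (\<lambda>y. descend g (orbit \<sigma> y)) x g"
proof -
  show ext: "smooth_extension S (\<lambda>y. descend g (orbit \<sigma> y)) x g" for x
    unfolding smooth_extension_def using assms
    by (intro exI[of _ UNIV]) (auto simp: descend_orbit)
  show "descend g \<in> smooth_algebra"
    unfolding mem_smooth_algebra_iff using ext by (auto simp: descend_def)
qed

abbreviation "derivations b \<equiv> tangent_space quotient_space smooth_algebra b"

lemma derivation_linear:
  assumes "D \<in> derivations b" and "f \<in> smooth_algebra" and "g \<in> smooth_algebra"
  shows "D (\<lambda>y\<in>orbit \<sigma> ` S. r * f y + s * g y) = r * D f + s * D g"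
  using assms by (simp add: tangent_space_def topspace_quotient_space)

lemma derivation_mult:
  assumes "D \<in> derivations b" and "f \<in> smooth_algebra" and "g \<in> smooth_algebra"
  shows "D (\<lambda>y\<in>orbit \<sigma> ` S. f y * g y) = f b * D g + g b * D f"
  using assms by (simp add: tangent_space_def topspace_quotient_space)

lemma derivation_zero:
  assumes "D \<in> derivations b"
  shows "(\<lambda>y\<in>orbit \<sigma> ` S. 0) \<in> smooth_algebra" and "D (\<lambda>y\<in>orbit \<sigma> ` S. 0) = 0"
proof -
  have "descend (\<lambda>_. 0) = (\<lambda>y\<in>orbit \<sigma> ` S. 0)"
    by (simp add: descend_def)
  then show zero: "(\<lambda>y\<in>orbit \<sigma> ` S. 0) \<in> smooth_algebra"
    using descend_in_smooth_algebra(1)[of "\<lambda>_. 0"] smooth_on_const by metis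
  have eq: "(\<lambda>y\<in>orbit \<sigma> ` S. 0 * (\<lambda>y\<in>orbit \<sigma> ` S. 0) y + 0 * (\<lambda>y\<in>orbit \<sigma> ` S. 0) y) = (\<lambda>y\<in>orbit \<sigma> ` S. 0::real)"
    by auto
  show "D (\<lambda>y\<in>orbit \<sigma> ` S. 0) = 0"
    using derivation_linear[OF assms zero zero, of 0 0] unfolding eq by simp
qed

lemma derivation_sum:
  assumes D: "D \<in> derivations b" and "finite I" and f: "\<And>i. i \<in> I \<Longrightarrow> f i \<in> smooth_algebra"
  shows "(\<lambda>y\<in>orbit \<sigma> ` S. \<Sum>i\<in>I. f i y) \<in> smooth_algebra"
    and "D (\<lambda>y\<in>orbit \<sigma> ` S. \<Sum>i\<in>I. f i y) = (\<Sum>i\<in>I. D (f i))"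
proof -
  have "(\<lambda>y\<in>orbit \<sigma> ` S. \<Sum>i\<in>I. f i y) \<in> smooth_algebra \<and>
      D (\<lambda>y\<in>orbit \<sigma> ` S. \<Sum>i\<in>I. f i y) = (\<Sum>i\<in>I. D (f i))"
    using assms(2) f
  proof (induction I rule: finite_induct)
    case empty
    then show ?case
      using derivation_zero[OF D] by (simp add: restrict_def)
  next
    case (insert i I)
    let ?g = "\<lambda>y\<in>orbit \<sigma> ` S. \<Sum>i\<in>I. f i y"
    have g: "?g \<in> smooth_algebra" "D ?g = (\<Sum>i\<in>I. D (f i))" and fi: "f i \<in> smooth_algebra"
      using insert.IH insert.prems by blast+
    have eq: "(\<lambda>y\<in>orbit \<sigma> ` S. \<Sum>i\<in>insert i I. f i y) = (\<lambda>y\<in>orbit \<sigma> ` S. 1 * f i y + 1 * ?g y)"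
      using insert.hyps by auto
    have "(\<lambda>y\<in>orbit \<sigma> ` S. \<Sum>i\<in>insert i I. f i y) \<in> smooth_algebra"
      unfolding eq by (rule smooth_algebra_linear_combination[OF fi g(1)])
    moreover have "D (\<lambda>y\<in>orbit \<sigma> ` S. \<Sum>i\<in>insert i I. f i y) = 1 * D (f i) + 1 * D ?g"
      unfolding eq by (rule derivation_linear[OF D fi g(1)])
    then have "D (\<lambda>y\<in>orbit \<sigma> ` S. \<Sum>i\<in>insert i I. f i y) = (\<Sum>i\<in>insert i I. D (f i))"
      using g(2) sum.insert[OF insert.hyps, of "\<lambda>i. D (f i)"] by linarith
    ultimately show ?case ..
  qed
  then show "(\<lambda>y\<in>orbit \<sigma> ` S. \<Sum>i\<in>I. f i y) \<in> smooth_algebra"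
    and "D (\<lambda>y\<in>orbit \<sigma> ` S. \<Sum>i\<in>I. f i y) = (\<Sum>i\<in>I. D (f i))"
    by blast+
qed

text \<open>The constant \<open>1\<close> is its own square, so by the Leibniz rule derivations kill it.\<close>

lemma derivation_minus_const:
  assumes D: "D \<in> derivations b" and f: "f \<in> smooth_algebra" and b: "b \<in> orbit \<sigma> ` S"
  shows "(\<lambda>y\<in>orbit \<sigma> ` S. f y - c) \<in> smooth_algebra" and "D (\<lambda>y\<in>orbit \<sigma> ` S. f y - c) = D f"
proof -
  let ?one = "\<lambda>y\<in>orbit \<sigma> ` S. 1::real"
  have "descend (\<lambda>_. 1) = ?one"
    by (simp add: descend_def)
  then have one: "?one \<in> smooth_algebra"
    using descend_in_smooth_algebra(1)[of "\<lambda>_. 1"] smooth_on_const by metis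
  have sq: "(\<lambda>y\<in>orbit \<sigma> ` S. ?one y * ?one y) = ?one"
    by auto
  have "D ?one = 0"
    using derivation_mult[OF D one one] b unfolding sq by auto
  moreover have "(\<lambda>y\<in>orbit \<sigma> ` S. f y - c) = (\<lambda>y\<in>orbit \<sigma> ` S. 1 * f y + (- c) * ?one y)"
    by auto
  ultimately show "(\<lambda>y\<in>orbit \<sigma> ` S. f y - c) \<in> smooth_algebra"
    and "D (\<lambda>y\<in>orbit \<sigma> ` S. f y - c) = D f"
    using smooth_algebra_linear_combination[OF f one, of 1 "- c"] derivation_linear[OF D f one, of 1 "- c"]
    by simp_all
qed

lemma disjoint_ball:
  assumes "x \<in> S"
  obtains R where "0 < R" and "\<And>y. y \<in> ball x R \<Longrightarrow> \<sigma> y \<notin> ball x R"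
proof -
  obtain V W where VW: "open V" "open W" "x \<in> V" "\<sigma> x \<in> W" "V \<inter> W = {}"
    using hausdorff[of x "\<sigma> x"] \<sigma>_free[OF assms] by metis
  have "open (\<sigma> -` W)"
    using VW(2) linear_continuous_on[OF bounded_linear_\<sigma>] by (simp add: open_vimage)
  then have "open (V \<inter> \<sigma> -` W)" and "x \<in> V \<inter> \<sigma> -` W"
    using VW by auto
  then obtain R where "0 < R" "ball x R \<subseteq> V \<inter> \<sigma> -` W"
    using open_contains_ball by metis
  with VW(5) that show thesis
    by blast
qed

text \<open>
  Around \<open>x\<close> choose a ball that is disjoint from its mirror image, so that functions
  supported in the ball can be symmetrised without interfering with their products.
  Hadamard's lemma writes \<open>f - f x\<close> near \<open>x\<close> as a sum of products of the coordinates
  \<open>y \<mapsto> (y - x) \<bullet> b\<close> with smooth functions; cut off by bump functions and symmetrised,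
  this becomes an identity in the algebra of the quotient, to which the Leibniz rule applies.
\<close>

lemma derivation_is_directional:
  assumes x: "x \<in> S" and D: "D \<in> derivations (orbit \<sigma> x)"
  obtains v where "\<And>f h. f \<in> smooth_algebra \<Longrightarrow> smooth_extension S (\<lambda>y. f (orbit \<sigma> y)) x h \<Longrightarrow>
    D f = frechet_derivative h (at x) v"
proof -
  obtain R where R: "0 < R" and disj: "\<And>y. y \<in> ball x R \<Longrightarrow> \<sigma> y \<notin> ball x R"
    using disjoint_ball[OF x] by blast
  obtain \<beta> where \<beta>: "smooth_on UNIV \<beta>" "\<beta> x = 1" "\<And>y. R \<le> dist y x \<Longrightarrow> \<beta> y = 0"
    using smooth_bump_function[OF R] by blast
  define sym where "sym \<phi> = descend (\<lambda>y. \<phi> y + \<phi> (\<sigma> y))" for \<phi> :: "'a \<Rightarrow> real"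
  have sym_in: "sym \<phi> \<in> smooth_algebra" if "smooth_on UNIV \<phi>" for \<phi>
    unfolding sym_def
    by (rule descend_in_smooth_algebra(1))
       (auto intro!: smooth_on_add that smooth_on_compose_linear[OF that bounded_linear_\<sigma>] add.commute)
  have sym_orbit: "sym \<phi> (orbit \<sigma> y) = \<phi> y + \<phi> (\<sigma> y)" if "y \<in> S" for \<phi> y
    unfolding sym_def by (rule descend_orbit[OF that]) (simp add: add.commute)
  have \<sigma>x: "\<sigma> x \<notin> ball x R"
    using disj[of x] R by simp
  define \<kappa> where "\<kappa> b y = \<beta> y * ((y - x) \<bullet> b)" for b y
  have \<kappa>: "smooth_on UNIV (\<kappa> b)" for b
  proof -
    have "smooth_on UNIV (\<lambda>y. (y - x) \<bullet> b)"
      using smooth_on_add[OF smooth_on_linear[OF bounded_linear_inner_left[of b]]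
          smooth_on_const[of _ "- (x \<bullet> b)"]] by (simp add: inner_diff_left)
    then show ?thesis
      unfolding \<kappa>_def by (rule smooth_on_mult[OF \<beta>(1)])
  qed
  (* The cut-off \<beta> is chosen before f, so that v does not depend on f; the smaller cut-off \<alpha> below
     restricts to the domain of the given extension of f. *)
  define v where "v = (\<Sum>b\<in>Basis. D (sym (\<kappa> b)) *\<^sub>R b)"
  show thesis
  proof (rule that[of v])
    fix f h assume f: "f \<in> smooth_algebra" and h: "smooth_extension S (\<lambda>y. f (orbit \<sigma> y)) x h"
    obtain U where U: "open U" "x \<in> U" "smooth_on U h" "\<And>y. y \<in> S \<Longrightarrow> y \<in> U \<Longrightarrow> f (orbit \<sigma> y) = h y"
      using h unfolding smooth_extension_def by blast
    obtain r where "0 < r" and r: "ball x r \<subseteq> U \<inter> ball x R"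
      using U(1,2) R open_contains_ball[of "U \<inter> ball x R"] by (metis Int_iff centre_in_ball open_Int open_ball)
    have hr: "smooth_on (ball x r) h"
      using smooth_on_subset[OF U(3)] r by blast
    obtain g where g: "\<And>b. smooth_on (ball x r) (g b)" "\<And>b. g b x = frechet_derivative h (at x) b"
        "\<And>y. y \<in> ball x r \<Longrightarrow> h y = h x + (\<Sum>b\<in>Basis. ((y - x) \<bullet> b) * g b y)"
      using smooth_on_first_order_expansion[OF hr \<open>0 < r\<close>] by blast
    obtain \<alpha> where \<alpha>: "smooth_on UNIV \<alpha>" "\<alpha> x = 1" "\<And>y. r / 2 \<le> dist y x \<Longrightarrow> \<alpha> y = 0"
      using smooth_bump_function[OF half_gt_zero[OF \<open>0 < r\<close>]] by blast
    define G where "G b y = (if y \<in> ball x r then \<alpha> y * g b y else 0)" for b y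
    have G: "smooth_on UNIV (G b)" for b
      unfolding G_def
      by (rule smooth_on_extend_by_zero[of \<alpha> "r / 2"]) (use \<alpha> g(1) \<open>0 < r\<close> in auto)
    have \<alpha>\<beta>: "smooth_on UNIV (\<lambda>y. \<alpha> y * \<beta> y)"
      by (rule smooth_on_mult[OF \<alpha>(1) \<beta>(1)])
    let ?c = "f (orbit \<sigma> x)"
    let ?f = "\<lambda>y\<in>orbit \<sigma> ` S. f y - ?c"
    have fx: "?c = h x"
      using U x by simp
    have outside: "\<beta> y = 0" "\<kappa> b y = 0" "G b y = 0" if "y \<notin> ball x R" for b y
      using that \<beta>(3)[of y] r by (auto simp: \<kappa>_def G_def dist_commute)
    have local_eq: "\<alpha> y * \<beta> y * (f (orbit \<sigma> y) - ?c) = (\<Sum>b\<in>Basis. \<kappa> b y * G b y)" if "y \<in> S" for y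
    proof (cases "y \<in> ball x r")
      case True
      then have "f (orbit \<sigma> y) - ?c = (\<Sum>b\<in>Basis. ((y - x) \<bullet> b) * g b y)"
        using U(4)[OF that] r g(3)[OF True] fx by auto
      then show ?thesis
        using True by (simp add: \<kappa>_def G_def sum_distrib_left mult_ac)
    next
      case False
      then have "\<alpha> y = 0"
        using \<alpha>(3)[of y] \<open>0 < r\<close> by (simp add: dist_commute)
      then show ?thesis
        using False by (simp add: G_def)
    qed
    have eq: "(\<lambda>y\<in>orbit \<sigma> ` S. sym (\<lambda>y. \<alpha> y * \<beta> y) y * ?f y) =
        (\<lambda>y\<in>orbit \<sigma> ` S. \<Sum>b\<in>Basis. (\<lambda>y\<in>orbit \<sigma> ` S. sym (\<kappa> b) y * sym (G b) y) y)"
    proof (rule restrict_ext)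
      fix b assume "b \<in> orbit \<sigma> ` S"
      then obtain y where y: "y \<in> S" "b = orbit \<sigma> y"
        by blast
      have "(\<alpha> y * \<beta> y + \<alpha> (\<sigma> y) * \<beta> (\<sigma> y)) * (f (orbit \<sigma> y) - ?c) =
          (\<Sum>b\<in>Basis. \<kappa> b y * G b y) + (\<Sum>b\<in>Basis. \<kappa> b (\<sigma> y) * G b (\<sigma> y))"
        using local_eq[OF y(1)] local_eq[OF \<sigma>_in[OF y(1)]] by (simp add: ring_distribs)
      also have "\<dots> = (\<Sum>b\<in>Basis. (\<kappa> b y + \<kappa> b (\<sigma> y)) * (G b y + G b (\<sigma> y)))"
      proof (cases "y \<in> ball x R")
        case True
        then show ?thesis
          using outside[OF disj[OF True]] by simp
      next
        case False
        then show ?thesis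
          using outside[OF False] by simp
      qed
      finally show "sym (\<lambda>y. \<alpha> y * \<beta> y) b * ?f b =
          (\<Sum>c\<in>Basis. (\<lambda>y\<in>orbit \<sigma> ` S. sym (\<kappa> c) y * sym (G c) y) b)"
        using y by (simp add: sym_orbit)
    qed
    note f' = derivation_minus_const[OF D f imageI[OF x], of ?c]
    have "D f = D (\<lambda>y\<in>orbit \<sigma> ` S. sym (\<lambda>y. \<alpha> y * \<beta> y) y * ?f y)"
      using derivation_mult[OF D sym_in[OF \<alpha>\<beta>] f'(1)] f'(2) x outside[OF \<sigma>x]
      by (simp add: sym_orbit \<alpha>(2) \<beta>(2))
    also have "\<dots> = (\<Sum>b\<in>Basis. D (\<lambda>y\<in>orbit \<sigma> ` S. sym (\<kappa> b) y * sym (G b) y))"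
      unfolding eq by (intro derivation_sum(2)[OF D] smooth_algebra_mult sym_in \<kappa> G) simp
    also have "\<dots> = (\<Sum>b\<in>Basis. D (sym (\<kappa> b)) * frechet_derivative h (at x) b)"
    proof (rule sum.cong[OF refl])
      fix b :: 'a
      have "sym (\<kappa> b) (orbit \<sigma> x) = 0"
        using outside[OF \<sigma>x] by (simp add: sym_orbit x) (simp add: \<kappa>_def)
      moreover have "sym (G b) (orbit \<sigma> x) = frechet_derivative h (at x) b"
        using outside[OF \<sigma>x] \<open>0 < r\<close> by (simp add: sym_orbit x) (simp add: G_def \<alpha>(2) g(2))
      ultimately show "D (\<lambda>y\<in>orbit \<sigma> ` S. sym (\<kappa> b) y * sym (G b) y) =
          D (sym (\<kappa> b)) * frechet_derivative h (at x) b"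
        using derivation_mult[OF D sym_in[OF \<kappa>] sym_in[OF G]] by simp
    qed
    also have "\<dots> = frechet_derivative h (at x) v"
    proof -
      have lin: "linear (frechet_derivative h (at x))"
        using has_derivative_linear[OF has_derivative_smooth_extension[OF h]] .
      show ?thesis
        by (simp add: v_def linear_sum[OF lin] linear_scale[OF lin])
    qed
    finally show "D f = frechet_derivative h (at x) v" .
  qed
qed

text \<open>A function that is constant on \<open>S\<close> also has a constant extension.\<close>

lemma directional_derivation_constant:
  assumes x: "x \<in> S" and D: "D \<in> derivations (orbit \<sigma> x)"
    and v: "\<And>f h. f \<in> smooth_algebra \<Longrightarrow> smooth_extension S (\<lambda>y. f (orbit \<sigma> y)) x h \<Longrightarrow>
      D f = frechet_derivative h (at x) v"
    and g: "smooth_on UNIV g" "\<And>y. y \<in> S \<Longrightarrow> g y = c"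
  shows "frechet_derivative g (at x) v = 0"
proof -
  have inv: "g (\<sigma> y) = g y" if "y \<in> S" for y
    using that g(2) by simp
  note desc = descend_in_smooth_algebra[OF g(1) inv]
  have "smooth_extension S (\<lambda>y. descend g (orbit \<sigma> y)) x (\<lambda>_. c)"
    unfolding smooth_extension_def
    by (intro exI[of _ UNIV]) (auto simp: smooth_on_const descend_orbit[where g = g] inv g(2))
  from v[OF desc(1) this] v[OF desc] show ?thesis
    by simp
qed

text \<open>Linearity and the Leibniz rule hold for the derivative along a curve with velocity \<open>v\<close>.\<close>

lemma velocity_derivative_in_derivations:
  assumes x: "x \<in> S" and "tangent_vector S x v"
  shows "(\<lambda>f\<in>smooth_algebra. velocity_derivative S (\<lambda>y. f (orbit \<sigma> y)) x v) \<in> derivations (orbit \<sigma> x)"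
    (is "?D \<in> _")
proof -
  obtain \<gamma> where \<gamma>: "\<gamma> 0 = x" "(\<gamma> has_vector_derivative v) (at 0)" "\<forall>\<^sub>F s in at (0::real). \<gamma> s \<in> S"
    using assms(2) unfolding tangent_vector_def by blast
  have deriv: "((\<lambda>s. f (orbit \<sigma> (\<gamma> s))) has_real_derivative ?D f) (at 0)" if f: "f \<in> smooth_algebra" for f
  proof -
    obtain h where "smooth_extension S (\<lambda>y. f (orbit \<sigma> y)) x h"
      using f x unfolding mem_smooth_algebra_iff by blast
    from DERIV_along_curve[OF this x \<gamma>] f show ?thesis
      by simp
  qed
  have eqI: "?D k = d" if k: "k \<in> smooth_algebra" and d: "(K has_real_derivative d) (at 0)"
    and eq: "\<And>s. \<gamma> s \<in> S \<Longrightarrow> k (orbit \<sigma> (\<gamma> s)) = K s" for k K d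
  proof -
    have "\<forall>\<^sub>F s in at 0. K s = k (orbit \<sigma> (\<gamma> s))"
      using \<gamma>(3) by eventually_elim (use eq in auto)
    moreover have "K 0 = k (orbit \<sigma> (\<gamma> 0))"
      using \<gamma>(1) x eq[of 0] by simp
    ultimately have "((\<lambda>s. k (orbit \<sigma> (\<gamma> s))) has_real_derivative d) (at 0)"
      using has_derivative_transform_eventually[OF d[unfolded has_field_derivative_def]]
      unfolding has_field_derivative_def by simp
    then show ?thesis
      using DERIV_unique deriv[OF k] by blast
  qed
  show ?thesis
    unfolding tangent_space_def topspace_quotient_space
  proof (intro CollectI conjI ballI allI)
    fix f g a b assume fg: "f \<in> smooth_algebra" "g \<in> smooth_algebra"
    show "?D (\<lambda>y\<in>orbit \<sigma> ` S. a * f y + b * g y) = a * ?D f + b * ?D g"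
      by (rule eqI[OF smooth_algebra_linear_combination[OF fg]
            DERIV_add[OF DERIV_cmult[OF deriv[OF fg(1)]] DERIV_cmult[OF deriv[OF fg(2)]]]]) simp
    show "?D (\<lambda>y\<in>orbit \<sigma> ` S. f y * g y) = f (orbit \<sigma> x) * ?D g + g (orbit \<sigma> x) * ?D f"
      using eqI[OF smooth_algebra_mult[OF fg] DERIV_mult[OF deriv[OF fg(1)] deriv[OF fg(2)]]] \<gamma>(1)
      by (simp add: mult.commute add.commute)
  qed simp
qed

lemma derivations_add:
  assumes "D \<in> derivations b" and "E \<in> derivations b"
  shows "(\<lambda>f\<in>smooth_algebra. D f + E f) \<in> derivations b"
  using assms smooth_algebra_linear_combination smooth_algebra_mult
  unfolding tangent_space_def topspace_quotient_space by (auto simp: algebra_simps)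

lemma derivations_scale:
  assumes "D \<in> derivations b"
  shows "(\<lambda>f\<in>smooth_algebra. c * D f) \<in> derivations b"
  using assms smooth_algebra_linear_combination smooth_algebra_mult
  unfolding tangent_space_def topspace_quotient_space by (auto simp: algebra_simps)

end



section \<open>Continuous maps on spaces over a quotient\<close>

lemma continuous_map_in_topspace: "continuous_map X Y f \<Longrightarrow> x \<in> topspace X \<Longrightarrow> f x \<in> topspace Y"
  unfolding continuous_map_def by blast

definition fibre_product :: "'a topology \<Rightarrow> 'c topology \<Rightarrow> ('a \<Rightarrow> 'b) \<Rightarrow> ('c \<Rightarrow> 'b) \<Rightarrow> ('a \<times> 'c) topology" where
  "fibre_product X Z p \<rho> = subtopology (prod_topology X Z) {(x, y). p x = \<rho> y}"

lemma topspace_fibre_product: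
  "topspace (fibre_product X Z p \<rho>) = {(x, y). x \<in> topspace X \<and> y \<in> topspace Z \<and> p x = \<rho> y}"
  by (auto simp: fibre_product_def)

lemma continuous_map_fibre_product_fst: "continuous_map (fibre_product X Z p \<rho>) X fst"
  and continuous_map_fibre_product_snd: "continuous_map (fibre_product X Z p \<rho>) Z snd"
  by (simp_all add: fibre_product_def continuous_map_from_subtopology continuous_map_fst continuous_map_snd)

text \<open>
  The base change \<open>X \<times>\<^sub>B Z \<rightarrow> Z\<close> of an open surjection \<open>p\<close> is again an open surjection: a box
  \<open>N \<times> M\<close> is mapped onto \<open>M \<inter> \<rho>\<^sup>-\<^sup>1 (p N)\<close>. Continuity on \<open>Z\<close> may hence be checked after
  choosing representatives in \<open>X\<close> of the base points.
\<close>

lemma continuous_map_over_open_map: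
  assumes p: "open_map X B p" "p ` topspace X = topspace B"
    and \<rho>: "continuous_map Z B \<rho>"
    and g: "continuous_map (fibre_product X Z p \<rho>) W (\<lambda>(x, y). g y)"
  shows "continuous_map Z W g"
  unfolding continuous_map_def
proof (intro conjI allI impI)
  have lift: "\<exists>x\<in>topspace X. p x = \<rho> y" if "y \<in> topspace Z" for y
  proof -
    have "\<rho> y \<in> p ` topspace X"
      using \<rho> that unfolding p(2) continuous_map_def by blast
    then show ?thesis
      by force
  qed
  show "g \<in> topspace Z \<rightarrow> topspace W"
  proof
    fix y assume y: "y \<in> topspace Z"
    then obtain x where "x \<in> topspace X" "p x = \<rho> y"
      using lift by blast
    then show "g y \<in> topspace W"
      using continuous_map_in_topspace[OF g, of "(x, y)"] y by (simp add: topspace_fibre_product)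
  qed
  fix V assume V: "openin W V"
  have "openin (fibre_product X Z p \<rho>) {q \<in> topspace (fibre_product X Z p \<rho>). (\<lambda>(x, y). g y) q \<in> V}"
    by (rule openin_continuous_map_preimage[OF g V])
  then obtain O' where O': "openin (prod_topology X Z) O'"
    and eq: "{q \<in> topspace (fibre_product X Z p \<rho>). (\<lambda>(x, y). g y) q \<in> V} = O' \<inter> {(x, y). p x = \<rho> y}"
    unfolding fibre_product_def openin_subtopology by blast
  show "openin Z {y \<in> topspace Z. g y \<in> V}"
  proof (subst openin_subopen, intro ballI)
    fix y assume "y \<in> {y \<in> topspace Z. g y \<in> V}"
    then have y: "y \<in> topspace Z" "g y \<in> V"
      by auto
    obtain x where x: "x \<in> topspace X" "p x = \<rho> y"
      using lift[OF y(1)] by blast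
    then have "(x, y) \<in> {q \<in> topspace (fibre_product X Z p \<rho>). (\<lambda>(x, y). g y) q \<in> V}"
      using y by (simp add: topspace_fibre_product)
    then have "(x, y) \<in> O'"
      unfolding eq by blast
    then obtain N M where NM: "openin X N" "openin Z M" "x \<in> N" "y \<in> M" "N \<times> M \<subseteq> O'"
      using O' unfolding openin_prod_topology_alt by metis
    have "openin Z (M \<inter> {y \<in> topspace Z. \<rho> y \<in> p ` N})"
      using NM(1,2) p(1) unfolding open_map_def
      by (intro openin_Int openin_continuous_map_preimage[OF \<rho>]) auto
    moreover have "y \<in> M \<inter> {y \<in> topspace Z. \<rho> y \<in> p ` N}"
      using NM(3,4) x y(1) by (auto intro: image_eqI[of _ _ x])
    moreover have "M \<inter> {y \<in> topspace Z. \<rho> y \<in> p ` N} \<subseteq> {y \<in> topspace Z. g y \<in> V}"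
    proof
      fix y' assume "y' \<in> M \<inter> {y \<in> topspace Z. \<rho> y \<in> p ` N}"
      then obtain x' where "x' \<in> N" "p x' = \<rho> y'" "y' \<in> M" "y' \<in> topspace Z"
        by auto
      then have "(x', y') \<in> O' \<inter> {(x, y). p x = \<rho> y}"
        using NM(5) by auto
      then show "y' \<in> {y \<in> topspace Z. g y \<in> V}"
        unfolding eq[symmetric] using \<open>y' \<in> topspace Z\<close> by simp
    qed
    ultimately show "\<exists>T. openin Z T \<and> y \<in> T \<and> T \<subseteq> {y \<in> topspace Z. g y \<in> V}"
      by blast
  qed
qed

text \<open>
  The inverse of \<open>h\<close> is only given by a formula \<open>G\<close> in terms of a representative of the base
  point. Injectivity of \<open>h\<close> makes the formula independent of the representative.
\<close>

lemma homeomorphic_map_over_open_map: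
  assumes p: "open_map X B p" "p ` topspace X = topspace B"
    and \<rho>: "continuous_map F B \<rho>"
    and h: "continuous_map E F h" "inj_on h (topspace E)"
    and G: "continuous_map (fibre_product X F p \<rho>) E (\<lambda>(x, y). G x y)"
    and hG: "\<And>x y. x \<in> topspace X \<Longrightarrow> y \<in> topspace F \<Longrightarrow> p x = \<rho> y \<Longrightarrow> h (G x y) = y"
  shows "homeomorphic_map E F h"
proof -
  define g where "g = inv_into (topspace E) h"
  have G_in: "G x y \<in> topspace E" if "x \<in> topspace X" "y \<in> topspace F" "p x = \<rho> y" for x y
    using continuous_map_in_topspace[OF G, of "(x, y)"] that by (simp add: topspace_fibre_product)
  have gG: "g y = G x y" if "x \<in> topspace X" "y \<in> topspace F" "p x = \<rho> y" for x y
    unfolding g_def by (rule inv_into_f_eq[OF h(2) G_in[OF that] hG[OF that]])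
  have lift: "\<exists>x\<in>topspace X. p x = \<rho> y" if "y \<in> topspace F" for y
  proof -
    have "\<rho> y \<in> p ` topspace X"
      using \<rho> that unfolding p(2) continuous_map_def by blast
    then show ?thesis
      by force
  qed
  have "continuous_map F E g"
  proof (rule continuous_map_over_open_map[OF p \<rho>])
    show "continuous_map (fibre_product X F p \<rho>) E (\<lambda>(x, y). g y)"
      by (rule continuous_map_eq[OF G]) (auto simp: topspace_fibre_product gG)
  qed
  moreover have "h (g y) = y" if y: "y \<in> topspace F" for y
  proof -
    obtain x where "x \<in> topspace X" "p x = \<rho> y"
      using lift[OF y] by blast
    then show ?thesis
      using gG hG y by simp
  qed
  moreover have "g (h e) = e" if "e \<in> topspace E" for e
    unfolding g_def by (rule inv_into_f_f[OF h(2) that])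
  ultimately show ?thesis
    using h(1) unfolding homeomorphic_map_maps homeomorphic_maps_def by blast
qed

lemma continuous_map_compose_continuous_on:
  assumes "continuous_map P (top_of_set S) g" and "continuous_on S f"
  shows "continuous_map P euclidean (\<lambda>q. f (g q))"
  using continuous_map_compose[OF assms(1), of euclidean f] assms(2) by (simp add: o_def)

lemma continuous_map_euclidean_compose2:
  fixes f :: "'p \<Rightarrow> 'b::t2_space" and g :: "'p \<Rightarrow> 'c::t2_space"
  assumes "continuous_map P euclidean f" and "continuous_map P euclidean g"
    and "continuous_on UNIV (\<lambda>(x, y). F x y)"
  shows "continuous_map P euclidean (\<lambda>q. F (f q) (g q))"
proof -
  have "limitin euclidean (\<lambda>q. F (f q) (g q)) (F (f q) (g q)) (atin P q)" if "q \<in> topspace P" for q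
  proof -
    have "(f \<longlongrightarrow> f q) (atin P q)" "(g \<longlongrightarrow> g q) (atin P q)"
      using assms(1,2) that by (simp_all add: continuous_map_atin)
    then have "((\<lambda>q. (f q, g q)) \<longlongrightarrow> (f q, g q)) (atin P q)"
      by (rule tendsto_Pair)
    moreover have "isCont (\<lambda>(x, y). F x y) (f q, g q)"
      using assms(3) by (simp add: continuous_on_eq_continuous_at)
    ultimately show ?thesis
      using isCont_tendsto_compose[of "(f q, g q)" "\<lambda>(x, y). F x y" "\<lambda>q. (f q, g q)"] by simp
  qed
  then show ?thesis
    by (simp add: continuous_map_atin)
qed


section \<open>Isomorphisms of vector bundles\<close>

lemma fibre_restrict_bundle: "b \<in> U \<Longrightarrow> fibre (restrict_bundle E U) b = fibre E b"
  by (auto simp: fibre_def restrict_bundle_def)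

lemma restrict_bundle_simps [simp]:
  "base (restrict_bundle E U) = subtopology (base E) U"
  "total (restrict_bundle E U) = subtopology (total E) {e. proj E e \<in> U}"
  "proj (restrict_bundle E U) = proj E"
  "vadd (restrict_bundle E U) = vadd E"
  "vscale (restrict_bundle E U) = vscale E"
  by (simp_all add: restrict_bundle_def)

lemma bundle_iso_fibre:
  assumes "bundle_iso E F h" and "e \<in> fibre E b"
  shows "h e \<in> fibre F b"
  using assms homeomorphic_imp_surjective_map[of "total E" "total F" h]
  unfolding bundle_iso_def fibre_def by force

lemma bundle_iso_compose:
  assumes h: "bundle_iso E F h" and k: "bundle_iso F G k" and "topspace (base E) = topspace (base F)"
  shows "bundle_iso E G (k \<circ> h)"
proof -
  have h_in: "h e \<in> topspace (total F)" if "e \<in> topspace (total E)" for e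
    using h that homeomorphic_imp_surjective_map unfolding bundle_iso_def by blast
  show ?thesis
    unfolding bundle_iso_def
  proof (intro conjI ballI allI)
    show "homeomorphic_map (total E) (total G) (k \<circ> h)"
      using h k unfolding bundle_iso_def by (blast intro: homeomorphic_map_compose)
    show "proj G ((k \<circ> h) e) = proj E e" if "e \<in> topspace (total E)" for e
      using h k h_in[OF that] that unfolding bundle_iso_def by simp
    show "(k \<circ> h) (vscale E c e) = vscale G c ((k \<circ> h) e)" if "e \<in> topspace (total E)" for e c
      using h k h_in[OF that] that unfolding bundle_iso_def by simp
    show "(k \<circ> h) (vadd E e e') = vadd G ((k \<circ> h) e) ((k \<circ> h) e')"
      if "b \<in> topspace (base E)" "e \<in> fibre E b" "e' \<in> fibre E b" for b e e'
    proof -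
      have "h (vadd E e e') = vadd F (h e) (h e')"
        using h that unfolding bundle_iso_def by blast
      moreover have "k (vadd F (h e) (h e')) = vadd G (k (h e)) (k (h e'))"
        using k that bundle_iso_fibre[OF h] assms(3) unfolding bundle_iso_def by blast
      ultimately show ?thesis
        by simp
    qed
  qed
qed

lemma bundle_iso_restrict:
  assumes h: "bundle_iso E F h"
  shows "bundle_iso (restrict_bundle E U) (restrict_bundle F U) h"
  unfolding bundle_iso_def
proof (intro conjI ballI allI)
  show "homeomorphic_map (total (restrict_bundle E U)) (total (restrict_bundle F U)) h"
    unfolding restrict_bundle_simps
    by (rule homeomorphic_map_subtopologies_alt) (use h in \<open>auto simp: bundle_iso_def\<close>)
  show "h (vadd (restrict_bundle E U) e e') = vadd (restrict_bundle F U) (h e) (h e')"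
    if "b \<in> topspace (base (restrict_bundle E U))" "e \<in> fibre (restrict_bundle E U) b"
      "e' \<in> fibre (restrict_bundle E U) b" for b e e'
  proof -
    have "b \<in> U" "b \<in> topspace (base E)"
      using that(1) by auto
    then show ?thesis
      using h that(2,3) fibre_restrict_bundle[of b U E] unfolding bundle_iso_def by simp
  qed
qed (use h in \<open>auto simp: bundle_iso_def\<close>)

text \<open>
  Local triviality passes along an isomorphism, so it needs to be established only on the
  side of the line bundle.
\<close>

lemma vector_bundle_transport:
  assumes h: "bundle_iso E F h" and F: "vector_bundle F" and base: "base E = base F"
    and proj: "continuous_map (total E) (base E) (proj E)"
    and closed: "\<And>b e e'. b \<in> topspace (base E) \<Longrightarrow> e \<in> fibre E b \<Longrightarrow> e' \<in> fibre E b \<Longrightarrow>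
      vadd E e e' \<in> fibre E b"
      "\<And>b e c. b \<in> topspace (base E) \<Longrightarrow> e \<in> fibre E b \<Longrightarrow> vscale E c e \<in> fibre E b"
  shows "vector_bundle E"
  unfolding vector_bundle_def
proof (intro conjI ballI allI)
  fix b assume "b \<in> topspace (base E)"
  then obtain U k t where U: "openin (base F) U" "b \<in> U"
    and t: "bundle_iso (restrict_bundle F U) (trivial_bundle (subtopology (base F) U) k) t"
    using F unfolding vector_bundle_def base by blast
  have "bundle_iso (restrict_bundle E U) (trivial_bundle (subtopology (base E) U) k) (t \<circ> h)"
    using bundle_iso_compose[OF bundle_iso_restrict[OF h] t] by (simp add: base)
  then show "\<exists>U k h. openin (base E) U \<and> b \<in> U \<and>
      bundle_iso (restrict_bundle E U) (trivial_bundle (subtopology (base E) U) k) h"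
    using U base by auto
qed (use proj closed in auto)


section \<open>Multiples of the line bundle of a double cover\<close>

context free_linear_involution
begin

lemma open_map_orbit: "open_map (top_of_set S) quotient_space (orbit \<sigma>)"
  unfolding open_map_def
proof (intro allI impI)
  fix N assume N: "openin (top_of_set S) N"
  have "{x \<in> topspace (top_of_set S). orbit \<sigma> x \<in> orbit \<sigma> ` N} =
      N \<union> {x \<in> topspace (top_of_set S). \<sigma> x \<in> N}"
  proof -
    have "N \<subseteq> S"
      using openin_subset[OF N] by simp
    moreover have "orbit \<sigma> x \<in> orbit \<sigma> ` N \<longleftrightarrow> x \<in> N \<or> \<sigma> x \<in> N" for x
      by (auto simp: orbit_eq_iff image_iff)
    ultimately show ?thesis
      by auto
  qed
  moreover have "continuous_map (top_of_set S) (top_of_set S) \<sigma>"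
    using linear_continuous_on[OF bounded_linear_\<sigma>] by (auto simp: continuous_map_in_subtopology)
  then have "openin (top_of_set S) {x \<in> topspace (top_of_set S). \<sigma> x \<in> N}"
    using N by (rule openin_continuous_map_preimage)
  ultimately show "openin quotient_space (orbit \<sigma> ` N)"
    using N openin_subset[OF N] by (auto simp: openin_quotient_topology openin_Un)
qed

lemma continuous_map_orbit: "continuous_map (top_of_set S) quotient_space (orbit \<sigma>)"
  using quotient_map_quotient_topology quotient_imp_continuous_map by blast

lemma orbit_image_topspace: "orbit \<sigma> ` topspace (top_of_set S) = topspace quotient_space"
  by (simp add: topspace_quotient_space)

abbreviation "line_bundle \<equiv> double_cover_line_bundle (top_of_set S) \<sigma>"

definition line_class :: "'a \<Rightarrow> real \<Rightarrow> ('a \<times> real) set" where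
  "line_class x t = orbit (\<lambda>(x, t). (\<sigma> x, - t)) (x, t)"

lemma line_class_eq: "line_class x t = {(x, t), (\<sigma> x, - t)}"
  by (simp add: line_class_def orbit_def)

lemma line_class_\<sigma>: "line_class (\<sigma> x) (- t) = line_class x t"
  by (auto simp: line_class_eq)

text \<open>
  The vector \<open>x - \<sigma> x\<close> is odd under \<open>\<sigma>\<close> and does not vanish, so \<open>t (x - \<sigma> x)\<close> depends only
  on the class of \<open>(x, t)\<close>: this embeds the line bundle into a trivial bundle.
\<close>

definition line_vector :: "('a \<times> real) set \<Rightarrow> 'a" where
  "line_vector e = (case SOME p. p \<in> e of (x, t) \<Rightarrow> t *\<^sub>R (x - \<sigma> x))"

lemma line_vector_line_class: "line_vector (line_class x t) = t *\<^sub>R (x - \<sigma> x)"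
proof -
  have "(SOME p. p \<in> line_class x t) \<in> line_class x t"
    by (rule someI[of _ "(x, t)"]) (simp add: line_class_eq)
  then show ?thesis
    by (auto simp: line_vector_def line_class_eq scaleR_diff_right)
qed

text \<open>The real number \<open>t\<close> with \<open>e = line_class x t\<close>, for \<open>e\<close> in the fibre over the orbit of \<open>x\<close>.\<close>

definition line_coordinate :: "'a \<Rightarrow> ('a \<times> real) set \<Rightarrow> real" where
  "line_coordinate x e = (line_vector e \<bullet> (x - \<sigma> x)) / ((x - \<sigma> x) \<bullet> (x - \<sigma> x))"

lemma line_coordinate_line_class: "x \<in> S \<Longrightarrow> line_coordinate x (line_class x t) = t"
  using \<sigma>_free[of x] by (simp add: line_coordinate_def line_vector_line_class)

lemma line_class_inject: "x \<in> S \<Longrightarrow> line_class x s = line_class x t \<longleftrightarrow> s = t"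
  using line_coordinate_line_class by metis

lemma line_bundle_simps:
  "base line_bundle = quotient_space"
  "proj line_bundle (line_class x t) = orbit \<sigma> x"
  "x \<in> S \<Longrightarrow> vadd line_bundle (line_class x s) (line_class x t) = line_class x (s + t)"
  "vscale line_bundle c (line_class x t) = line_class x (c * t)"
proof -
  have "{(x, c * t) | x t. (x, t) \<in> e} = (\<lambda>(x, t). (x, c * t)) ` e" for e :: "('a \<times> real) set"
    by force
  then show "vscale line_bundle c (line_class x t) = line_class x (c * t)"
    by (simp add: double_cover_line_bundle_def line_class_eq)
qed (use \<sigma>_free[of x] in \<open>auto simp: double_cover_line_bundle_def line_class_eq orbit_def\<close>)

lemma fibre_line_bundle: "x \<in> S \<Longrightarrow> fibre line_bundle (orbit \<sigma> x) = range (line_class x)"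
proof -
  have "topspace (total line_bundle) = {line_class y t | y t. y \<in> S}"
    by (auto simp: double_cover_line_bundle_def topspace_quotient_topology line_class_def)
  then show "x \<in> S \<Longrightarrow> fibre line_bundle (orbit \<sigma> x) = range (line_class x)"
    using line_class_\<sigma>[of x] by (auto simp: fibre_def line_bundle_simps orbit_eq_iff) (metis minus_minus rangeI)
qed

lemma line_coordinate_inverse:
  assumes "x \<in> S" and "e \<in> fibre line_bundle (orbit \<sigma> x)"
  shows "line_class x (line_coordinate x e) = e"
  using assms line_coordinate_line_class by (auto simp: fibre_line_bundle)

lemma continuous_map_line_class:
  assumes "continuous_map P (top_of_set S) f" and "continuous_map P euclideanreal g"
  shows "continuous_map P (total line_bundle) (\<lambda>q. line_class (f q) (g q))"
proof -
  have "continuous_map P (prod_topology (top_of_set S) euclideanreal) (\<lambda>q. (f q, g q))"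
    using assms by (simp add: continuous_map_pairwise o_def)
  from continuous_map_compose[OF this quotient_imp_continuous_map[OF quotient_map_quotient_topology]]
  show ?thesis
    by (simp add: double_cover_line_bundle_def line_class_def o_def)
qed

lemma continuous_map_line_vector: "continuous_map (total line_bundle) euclidean line_vector"
proof -
  have "continuous_on S (\<lambda>x. x - \<sigma> x)"
    using linear_continuous_on[OF bounded_linear_\<sigma>] by (intro continuous_intros)
  then have "continuous_map (prod_topology (top_of_set S) euclideanreal) euclidean (\<lambda>q. fst q - \<sigma> (fst q))"
    by (rule continuous_map_compose_continuous_on[OF continuous_map_fst])
  moreover have "continuous_on UNIV (\<lambda>(t::real, v::'a). t *\<^sub>R v)"
    unfolding split_beta by (intro continuous_intros)
  ultimately have "continuous_map (prod_topology (top_of_set S) euclideanreal) euclidean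
      (\<lambda>(x, t). t *\<^sub>R (x - \<sigma> x))"
    unfolding split_beta
    by (intro continuous_map_euclidean_compose2[where F = "\<lambda>t v. t *\<^sub>R v", OF continuous_map_snd])
      (simp_all add: split_beta)
  moreover have "line_vector \<circ> orbit (\<lambda>(x, t). (\<sigma> x, - t)) = (\<lambda>(x, t). t *\<^sub>R (x - \<sigma> x))"
    by (auto simp: line_vector_line_class simp flip: line_class_def)
  ultimately show ?thesis
    unfolding double_cover_line_bundle_def
    by (simp add: continuous_compose_quotient_map[OF quotient_map_quotient_topology])
qed

lemma continuous_map_line_coordinate:
  assumes f: "continuous_map P (top_of_set S) f" and g: "continuous_map P (total line_bundle) g"
  shows "continuous_map P euclideanreal (\<lambda>q. line_coordinate (f q) (g q))"
proof -
  have "continuous_on S (\<lambda>x. x - \<sigma> x)"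
    using linear_continuous_on[OF bounded_linear_\<sigma>] by (intro continuous_intros) 
  from continuous_map_compose_continuous_on[OF f this]
  have odd: "continuous_map P euclidean (\<lambda>q. f q - \<sigma> (f q))" .
  have vec: "continuous_map P euclidean (\<lambda>q. line_vector (g q))"
    using continuous_map_compose[OF g continuous_map_line_vector] by (simp add: o_def)
  have inner: "continuous_on UNIV (\<lambda>(x::'a, y). x \<bullet> y)"
    unfolding split_beta by (intro continuous_intros)
  have "f q - \<sigma> (f q) \<noteq> 0" if "q \<in> topspace P" for q
    using continuous_map_in_topspace[OF f that] \<sigma>_free[of "f q"] by auto
  then show ?thesis
    unfolding line_coordinate_def
    by (intro continuous_map_real_divide continuous_map_euclidean_compose2[OF _ _ inner] vec odd) auto
qed

abbreviation "multiple k \<equiv> whitney_multiple k line_bundle"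

lemma multiple_simps:
  "base (multiple k) = quotient_space"
  "proj (multiple k) = fst"
  "x \<in> S \<Longrightarrow> vadd (multiple k) (b, \<lambda>i\<in>{..<k}. line_class x (s i)) (b', \<lambda>i\<in>{..<k}. line_class x (t i)) =
    (b, \<lambda>i\<in>{..<k}. line_class x (s i + t i))"
  "vscale (multiple k) c (b, \<lambda>i\<in>{..<k}. line_class x (s i)) = (b, \<lambda>i\<in>{..<k}. line_class x (c * s i))"
  by (auto simp: whitney_multiple_def line_bundle_simps fun_eq_iff)

lemma fibre_multiple:
  assumes "x \<in> S"
  shows "fibre (multiple k) (orbit \<sigma> x) = {(orbit \<sigma> x, \<lambda>i\<in>{..<k}. line_class x (t i)) | t. True}"
proof -
  have "fibre (multiple k) (orbit \<sigma> x) =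
      {orbit \<sigma> x} \<times> (\<Pi>\<^sub>E i\<in>{..<k}. fibre line_bundle (orbit \<sigma> x))"
    using assms by (auto simp: fibre_def whitney_multiple_def line_bundle_simps topspace_quotient_space PiE_iff)
  also have "\<dots> = {(orbit \<sigma> x, \<lambda>i\<in>{..<k}. line_class x (t i)) | t. True}"
  proof -
    have eq: "s = (\<lambda>i\<in>{..<k}. line_class x (line_coordinate x (s i)))"
      if "s \<in> (\<Pi>\<^sub>E i\<in>{..<k}. fibre line_bundle (orbit \<sigma> x))" for s
      using that line_coordinate_inverse[OF assms] by (fastforce simp: PiE_iff extensional_def fun_eq_iff)
    show ?thesis
    proof (intro equalityI subsetI)
      fix p assume "p \<in> {orbit \<sigma> x} \<times> (\<Pi>\<^sub>E i\<in>{..<k}. fibre line_bundle (orbit \<sigma> x))"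
      then obtain s where p: "p = (orbit \<sigma> x, s)"
        and s: "s \<in> (\<Pi>\<^sub>E i\<in>{..<k}. fibre line_bundle (orbit \<sigma> x))"
        by blast
      show "p \<in> {(orbit \<sigma> x, \<lambda>i\<in>{..<k}. line_class x (t i)) | t. True}"
        unfolding p
        by (intro CollectI exI[of _ "\<lambda>i. line_coordinate x (s i)"] conjI TrueI
            arg_cong[where f = "Pair (orbit \<sigma> x)", OF eq[OF s]])
    next
      fix p assume "p \<in> {(orbit \<sigma> x, \<lambda>i\<in>{..<k}. line_class x (t i)) | t. True}"
      then show "p \<in> {orbit \<sigma> x} \<times> (\<Pi>\<^sub>E i\<in>{..<k}. fibre line_bundle (orbit \<sigma> x))"
        by (auto simp: fibre_line_bundle[OF assms])
    qed
  qed
  finally show ?thesis .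
qed

lemma topspace_total_multiple:
  "topspace (total (multiple k)) =
    {(orbit \<sigma> x, \<lambda>i\<in>{..<k}. line_class x (t i)) | x t. x \<in> S}"
proof -
  have "topspace (total (multiple k)) = (\<Union>b\<in>orbit \<sigma> ` S. fibre (multiple k) b)"
    by (auto simp: fibre_def whitney_multiple_def line_bundle_simps topspace_quotient_space)
  then show ?thesis
    by (auto simp: fibre_multiple)
qed

lemma continuous_map_into_multiple:
  assumes f: "continuous_map P (top_of_set S) f" and g: "\<And>i. i < k \<Longrightarrow> continuous_map P euclideanreal (g i)"
  shows "continuous_map P (total (multiple k)) (\<lambda>q. (orbit \<sigma> (f q), \<lambda>i\<in>{..<k}. line_class (f q) (g i q)))"
proof -
  have "f q \<in> S" if "q \<in> topspace P" for q
    using f that by (auto simp: continuous_map_def)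
  then show ?thesis
    unfolding whitney_multiple_def
    using continuous_map_compose[OF f continuous_map_orbit] continuous_map_line_class[OF f g]
    by (auto simp: continuous_map_in_subtopology continuous_map_pairwise o_def
        continuous_map_componentwise line_bundle_simps fibre_line_bundle)
qed

lemma continuous_map_proj_multiple: "continuous_map (total (multiple k)) quotient_space fst"
  by (simp add: whitney_multiple_def line_bundle_simps continuous_map_from_subtopology continuous_map_fst)

lemma continuous_map_multiple_component:
  assumes "i < k"
  shows "continuous_map (total (multiple k)) (total line_bundle) (\<lambda>e. snd e i)"
proof -
  have "continuous_map (prod_topology quotient_space (product_topology (\<lambda>_. total line_bundle) {..<k}))
      (total line_bundle) ((\<lambda>s. s i) \<circ> snd)"
    using assms by (intro continuous_map_compose[OF continuous_map_snd] continuous_map_product_projection) simp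
  then show ?thesis
    by (simp add: whitney_multiple_def line_bundle_simps continuous_map_from_subtopology o_def)
qed

text \<open>
  Over the open set of orbits on which one coordinate of the odd vector \<open>x - \<sigma> x\<close> does not
  vanish, the same coordinate of \<open>line_vector\<close> trivialises the line bundle.
\<close>

lemma multiple_locally_trivial:
  assumes "x0 \<in> S"
  shows "\<exists>U h. openin quotient_space U \<and> orbit \<sigma> x0 \<in> U \<and>
    bundle_iso (restrict_bundle (multiple k) U) (trivial_bundle (subtopology quotient_space U) k) h"
proof -
  obtain b where b: "(x0 - \<sigma> x0) \<bullet> b \<noteq> 0"
    using \<sigma>_free[OF assms] by (metis eq_iff_diff_eq_0 inner_eq_zero_iff)
  define w where "w x = (x - \<sigma> x) \<bullet> b" for x
  have w: "continuous_on S w"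
    unfolding w_def using linear_continuous_on[OF bounded_linear_\<sigma>] by (intro continuous_intros)
  define U where "U = orbit \<sigma> ` {x \<in> S. w x \<noteq> 0}"
  have w_odd: "w (\<sigma> x) = - w x" for x
    by (simp add: w_def inner_diff_left)
  have in_U: "orbit \<sigma> x \<in> U \<longleftrightarrow> w x \<noteq> 0" if "x \<in> S" for x
    using that w_odd[of x] by (auto simp: U_def image_iff orbit_eq_iff)
  have "openin (top_of_set S) {x \<in> S. w x \<noteq> 0}"
    using continuous_openin_preimage_gen[OF w, of "- {0}"] by (auto simp: vimage_def Int_def)
  then have U: "openin quotient_space U"
    using open_map_orbit unfolding U_def open_map_def by blast
  define h where "h e = (fst e, \<lambda>i. if i < k then line_vector (snd e i) \<bullet> b else 0)"
    for e :: "'a set \<times> (nat \<Rightarrow> ('a \<times> real) set)"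
  have h_class: "h (c, \<lambda>i\<in>{..<k}. line_class x (t i)) = (c, \<lambda>i. if i < k then t i * w x else 0)" for c x t
    by (auto simp: h_def line_vector_line_class w_def)
  let ?E = "restrict_bundle (multiple k) U" and ?F = "trivial_bundle (subtopology quotient_space U) k"
  have E: "topspace (total ?E) = {(orbit \<sigma> x, \<lambda>i\<in>{..<k}. line_class x (t i)) | x t. x \<in> S \<and> w x \<noteq> 0}"
    by (auto simp: topspace_total_multiple multiple_simps in_U)
  have F: "total ?F = prod_topology (subtopology quotient_space U) (Euclidean_space k)"
    by (simp add: trivial_bundle_def)
  have E_sub: "continuous_map (total ?E) Z f" if "continuous_map (total (multiple k)) Z f" for Z :: "'z topology" and f
    using that by (simp add: continuous_map_from_subtopology)
  have "homeomorphic_map (total ?E) (total ?F) h"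
  proof (rule homeomorphic_map_over_open_map[OF open_map_orbit orbit_image_topspace])
    show "continuous_map (total ?F) quotient_space fst"
      unfolding F using continuous_map_fst continuous_map_in_subtopology by blast
    have "continuous_map (total ?E) euclideanreal (\<lambda>e. line_vector (snd e i) \<bullet> b)" if "i < k" for i
    proof -
      have "continuous_map (total ?E) euclidean (\<lambda>e. line_vector (snd e i))"
        using continuous_map_compose[OF E_sub[OF continuous_map_multiple_component[OF that]]
            continuous_map_line_vector] by (simp add: o_def)
      from continuous_map_compose[OF this, of euclideanreal "\<lambda>v. v \<bullet> b"] show ?thesis
        by (simp add: o_def continuous_on_inner)
    qed
    moreover have "fst e \<in> U" if "e \<in> topspace (total ?E)" for e
      using that in_U unfolding E by auto
    ultimately show "continuous_map (total ?E) (total ?F) h"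
      unfolding F h_def using E_sub[OF continuous_map_proj_multiple]
      by (auto simp: continuous_map_pairwise o_def continuous_map_in_subtopology
          continuous_map_componentwise_Euclidean_space simp del: restrict_bundle_simps)
    show "inj_on h (topspace (total ?E))"
    proof (rule inj_onI)
      fix e e' assume "e \<in> topspace (total ?E)" "e' \<in> topspace (total ?E)" and eq: "h e = h e'"
      then obtain x t x' where x: "x \<in> S" "w x \<noteq> 0" "e = (orbit \<sigma> x, \<lambda>i\<in>{..<k}. line_class x (t i))"
        and e': "x' \<in> S" "e' \<in> fibre (multiple k) (orbit \<sigma> x')"
        unfolding E using fibre_multiple by blast
      have "fst e = fst e'"
        using eq by (simp add: h_def)
      then have "e' \<in> fibre (multiple k) (orbit \<sigma> x)"
        using e'(2) x(3) by (simp add: fibre_def multiple_simps)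
      then obtain t' where e': "e' = (orbit \<sigma> x, \<lambda>i\<in>{..<k}. line_class x (t' i))"
        unfolding fibre_multiple[OF x(1)] by blast
      have "t i = t' i" if "i < k" for i
      proof -
        have "(\<lambda>i. if i < k then t i * w x else 0) = (\<lambda>i. if i < k then t' i * w x else 0)"
          using eq unfolding x(3) e' h_class by simp
        from fun_cong[OF this, of i] show ?thesis
          using that x(2) by simp
      qed
      then show "e = e'"
        unfolding x(3) e' by (auto intro!: restrict_ext)
    qed
    let ?P = "fibre_product (top_of_set S) (total ?F) (orbit \<sigma>) fst"
    define G where "G x f = (orbit \<sigma> x, \<lambda>i\<in>{..<k}. line_class x (snd f i / w x))"
      for x and f :: "'a set \<times> (nat \<Rightarrow> real)"
    have P: "fst q \<in> S" "w (fst q) \<noteq> 0" if "q \<in> topspace ?P" for q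
      using that in_U by (auto simp: topspace_fibre_product F)
    have coord: "continuous_map ?P euclideanreal (\<lambda>q. snd (snd q) i / w (fst q))" for i
    proof (rule continuous_map_real_divide)
      have "continuous_map (total ?F) euclideanreal ((\<lambda>y. y i) \<circ> snd)"
        unfolding F Euclidean_space_def
        by (intro continuous_map_compose[OF continuous_map_snd] continuous_map_from_subtopology
            continuous_map_product_projection) simp
      from continuous_map_compose[OF continuous_map_fibre_product_snd this]
      show "continuous_map ?P euclideanreal (\<lambda>q. snd (snd q) i)"
        by (simp add: o_def)
      show "continuous_map ?P euclideanreal (\<lambda>q. w (fst q))"
        by (rule continuous_map_compose_continuous_on[OF continuous_map_fibre_product_fst w])
    qed (use P in auto)
    have "continuous_map ?P (total (multiple k)) (\<lambda>q. G (fst q) (snd q))"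
      unfolding G_def by (rule continuous_map_into_multiple[OF continuous_map_fibre_product_fst coord])
    moreover have "proj (multiple k) (G (fst q) (snd q)) \<in> U" if "q \<in> topspace ?P" for q
      using P[OF that] in_U by (simp add: G_def multiple_simps)
    ultimately show "continuous_map ?P (total ?E) (\<lambda>(x, f). G x f)"
      by (simp add: continuous_map_in_subtopology split_beta' Pi_iff)
    show "h (G x f) = f" if "x \<in> topspace (top_of_set S)" "f \<in> topspace (total ?F)" "orbit \<sigma> x = fst f" for x f
      using that in_U unfolding G_def h_class F
      by (cases f) (auto simp: topspace_Euclidean_space fun_eq_iff)
  qed
  moreover have "h (vadd ?E e e') = vadd ?F (h e) (h e')"
    if c: "c \<in> topspace (base ?E)" and e: "e \<in> fibre ?E c" "e' \<in> fibre ?E c" for c e e'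
  proof -
    obtain x where x: "x \<in> S" "c = orbit \<sigma> x" "c \<in> U"
      using c by (auto simp: multiple_simps topspace_quotient_space)
    then obtain t t' where "e = (c, \<lambda>i\<in>{..<k}. line_class x (t i))" "e' = (c, \<lambda>i\<in>{..<k}. line_class x (t' i))"
      using e fibre_multiple[OF x(1)] by (auto simp: fibre_restrict_bundle)
    then show ?thesis
      by (auto simp: multiple_simps(3)[OF x(1)] h_class trivial_bundle_def fun_eq_iff distrib_right)
  qed
  moreover have "h (vscale ?E r e) = vscale ?F r (h e)" if "e \<in> topspace (total ?E)" for e r
    using that unfolding E by (auto simp: multiple_simps h_class trivial_bundle_def fun_eq_iff)
  moreover have "proj ?F (h e) = proj ?E e" for e
    by (simp add: h_def trivial_bundle_def multiple_simps)
  ultimately have "bundle_iso ?E ?F h"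
    unfolding bundle_iso_def by blast
  then show ?thesis
    using U in_U[OF assms] b by (auto simp: w_def)
qed

lemma vector_bundle_multiple: "vector_bundle (multiple k)"
  unfolding vector_bundle_def
proof (intro conjI ballI allI)
  show "continuous_map (total (multiple k)) (base (multiple k)) (proj (multiple k))"
    using continuous_map_proj_multiple by (simp add: multiple_simps)
  fix b assume "b \<in> topspace (base (multiple k))"
  then obtain x where x: "x \<in> S" "b = orbit \<sigma> x"
    by (auto simp: multiple_simps topspace_quotient_space)
  show "\<exists>U k' h. openin (base (multiple k)) U \<and> b \<in> U \<and>
      bundle_iso (restrict_bundle (multiple k) U) (trivial_bundle (subtopology (base (multiple k)) U) k') h"
    using multiple_locally_trivial[OF x(1)] unfolding x(2) multiple_simps by blast
  fix e assume e: "e \<in> fibre (multiple k) b"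
  show "vadd (multiple k) e e' \<in> fibre (multiple k) b" if "e' \<in> fibre (multiple k) b" for e'
    using e that unfolding x(2) fibre_multiple[OF x(1)] by (auto simp: multiple_simps(3)[OF x(1)])
  show "vscale (multiple k) c e \<in> fibre (multiple k) b" for c
    using e unfolding x(2) fibre_multiple[OF x(1)] by (auto simp: multiple_simps)
qed

end



section \<open>Tangent vectors of polygon spaces\<close>

lemma has_vector_derivative_vec_lambda:
  fixes f :: "real \<Rightarrow> 'm::finite \<Rightarrow> 'a::euclidean_space"
  assumes "\<And>j. ((\<lambda>s. f s j) has_vector_derivative f' j) (at x)"
  shows "((\<lambda>s. \<chi> j. f s j) has_vector_derivative (\<chi> j. f' j)) (at x)"
  unfolding has_vector_derivative_def
proof (subst has_derivative_componentwise_within, intro ballI)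
  fix b :: "'a ^ 'm" assume "b \<in> Basis"
  then obtain j u where b: "b = axis j u"
    by (auto simp: Basis_vec_def)
  have "((\<lambda>s. f s j \<bullet> u) has_derivative (\<lambda>c. (c *\<^sub>R f' j) \<bullet> u)) (at x)"
    using assms[of j] unfolding has_vector_derivative_def by (rule has_derivative_inner_left)
  then show "((\<lambda>s. (\<chi> j. f s j) \<bullet> b) has_derivative (\<lambda>c. (c *\<^sub>R (\<chi> j. f' j)) \<bullet> b)) (at x)"
    by (simp add: b inner_axis)
qed

lemma has_vector_derivative_cis: "(cis has_vector_derivative \<i> * cis x) (at x)"
proof -
  have "((\<lambda>z. exp (\<i> * z)) has_field_derivative \<i> * exp (\<i> * of_real x)) (at (of_real x))"
    by (auto intro!: derivative_eq_intros)
  from has_vector_derivative_real_field[OF this, of UNIV]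
  have "((\<lambda>t. cis t) has_vector_derivative \<i> * cis x) (at x)"
    by (simp only: cis_conv_exp)
  then show ?thesis .
qed

lemma bounded_linear_conjugation: "bounded_linear (conjugation :: complex ^ 'm::finite \<Rightarrow> complex ^ 'm)"
  by (rule linear_conv_bounded_linear[THEN iffD1], rule linearI) (simp_all add: conjugation_def vec_eq_iff)

locale polygons =
  fixes l :: "real ^ 'm::finite option"
  assumes length_vector: "length_vector l" and generic: "generic l"
begin

abbreviation "M \<equiv> polygon_space l"
abbreviation "len j \<equiv> l $ Some j"
abbreviation "last_len \<equiv> l $ None"

lemma last_len_pos: "0 < last_len" and len_pos: "0 < len j"
  using length_vector by (auto simp: length_vector_def)

lemma polygon_spaceD:
  assumes "z \<in> M"
  shows "(Re (z $ j))\<^sup>2 + (Im (z $ j))\<^sup>2 = 1"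
    and "(\<Sum>j\<in>UNIV. len j * Re (z $ j)) = last_len"
    and "(\<Sum>j\<in>UNIV. len j * Im (z $ j)) = 0"
proof -
  have "(cmod (z $ j))\<^sup>2 = 1"
    using assms by (simp add: polygon_space_def torus_def)
  then show "(Re (z $ j))\<^sup>2 + (Im (z $ j))\<^sup>2 = 1"
    by (simp add: cmod_power2)
  have "polygon_map l z = of_real last_len"
    using assms by (simp add: polygon_space_def)
  then show "(\<Sum>j\<in>UNIV. len j * Re (z $ j)) = last_len" "(\<Sum>j\<in>UNIV. len j * Im (z $ j)) = 0"
    by (simp_all add: polygon_map_def complex_eq_iff)
qed

text \<open>
  A polygon fixed by conjugation lies on a line, so its edges split into two sets of equal
  total length, which a generic length vector excludes.
\<close>

lemma conjugation_free:
  assumes z: "z \<in> M"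
  shows "conjugation z \<noteq> z"
proof
  assume "conjugation z = z"
  then have "cnj (z $ j) = z $ j" for j
    by (simp add: conjugation_def vec_eq_iff)
  then have im: "Im (z $ j) = 0" for j
    by (simp add: complex_eq_iff)
  have re: "Re (z $ j) = 1 \<or> Re (z $ j) = - 1" for j
    using polygon_spaceD(1)[OF z, of j] im by (simp add: power2_eq_1_iff)
  define A where "A = {j. Re (z $ j) = 1}"
  have "last_len = (\<Sum>j\<in>UNIV. (if j \<in> A then len j else 0) - (if j \<in> A then 0 else len j))"
    unfolding polygon_spaceD(2)[OF z, symmetric]
  proof (rule sum.cong[OF refl])
    show "len j * Re (z $ j) = (if j \<in> A then len j else 0) - (if j \<in> A then 0 else len j)" for j
      using re[of j] by (auto simp: A_def)
  qed
  also have "\<dots> = (\<Sum>j\<in>UNIV. if j \<in> A then len j else 0) - (\<Sum>j\<in>UNIV. if j \<in> A then 0 else len j)"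
    by (rule sum_subtractf)
  finally have eq: "(\<Sum>j\<in>UNIV. if j \<in> A then len j else 0) =
      last_len + (\<Sum>j\<in>UNIV. if j \<in> A then 0 else len j)"
    by simp
  have "(\<Sum>i\<in>Some ` A. l $ i) = (\<Sum>j\<in>UNIV. if j \<in> A then len j else 0)"
    by (simp add: sum.reindex sum.If_cases)
  moreover have "- (Some ` A) = insert None (Some ` (- A))"
  proof (rule set_eqI)
    show "i \<in> - (Some ` A) \<longleftrightarrow> i \<in> insert None (Some ` (- A))" for i
      by (cases i) auto
  qed
  then have "(\<Sum>i\<in>- (Some ` A). l $ i) = last_len + (\<Sum>j\<in>UNIV. if j \<in> A then 0 else len j)"
    by (simp add: sum.reindex sum.If_cases)
  ultimately have "(\<Sum>i\<in>Some ` A. l $ i) = (\<Sum>i\<in>- (Some ` A). l $ i)"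
    using eq by simp
  then show False
    using generic unfolding generic_def by blast
qed

sublocale free_linear_involution M conjugation
proof (rule free_linear_involution.intro)
  show "conjugation (conjugation x) = x" for x :: "complex ^ 'm"
    by (simp add: conjugation_def vec_eq_iff)
  show "conjugation x \<in> M" if "x \<in> M" for x
  proof -
    have "polygon_map l (conjugation x) = cnj (polygon_map l x)"
      by (simp add: polygon_map_def conjugation_def)
    then show ?thesis
      using that by (auto simp: polygon_space_def torus_def conjugation_def)
  qed
qed (auto simp: bounded_linear_conjugation conjugation_free)

lemma conjugation_nth [simp]: "conjugation z $ j = cnj (z $ j)"
  by (simp add: conjugation_def)

definition vertical :: "complex ^ 'm \<Rightarrow> real" where
  "vertical z = (\<Sum>j\<in>UNIV. len j * (Im (z $ j))\<^sup>2)"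

lemma vertical_pos:
  assumes "z \<in> M"
  shows "0 < vertical z"
proof -
  obtain j where "cnj (z $ j) \<noteq> z $ j"
    using conjugation_free[OF assms] by (auto simp: vec_eq_iff)
  then have "Im (z $ j) \<noteq> 0"
    by (auto simp: complex_eq_iff)
  then have "0 < len j * (Im (z $ j))\<^sup>2"
    using len_pos by simp
  also have "\<dots> \<le> vertical z"
    unfolding vertical_def
    by (rule member_le_sum) (auto intro: mult_nonneg_nonneg less_imp_le[OF len_pos])
  finally show ?thesis .
qed

lemma vertical_conjugation [simp]: "vertical (conjugation z) = vertical z"
  by (simp add: vertical_def)

text \<open>
  The velocity of \<open>z\<close> when its edges rotate with angular velocities \<open>t\<close>; the end point of
  the polygonal line stays fixed to first order iff \<open>closing z t\<close>.
\<close>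

definition velocity :: "complex ^ 'm \<Rightarrow> ('m \<Rightarrow> real) \<Rightarrow> complex ^ 'm" where
  "velocity z t = (\<chi> j. \<i> * of_real (t j) * z $ j)"

definition closing :: "complex ^ 'm \<Rightarrow> ('m \<Rightarrow> real) \<Rightarrow> bool" where
  "closing z t \<longleftrightarrow> (\<Sum>j\<in>UNIV. len j * Re (z $ j) * t j) = 0 \<and> (\<Sum>j\<in>UNIV. len j * Im (z $ j) * t j) = 0"

lemma velocity_nth: "velocity z t $ j = \<i> * of_real (t j) * z $ j"
  by (simp add: velocity_def)

text \<open>
  In terms of the angles of the edges, the polygon space is the level set of a function whose
  derivative is onto, since rotating all edges by the same angle moves the end point vertically,
  and a combination of this with the angular velocities \<open>j \<mapsto> Im (z $ j)\<close> moves it horizontally.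
\<close>

lemma tangent_vector_velocity:
  assumes z: "z \<in> M" and t: "closing z t"
  shows "tangent_vector M z (velocity z t)"
proof -
  define f :: "real ^ 'm \<Rightarrow> complex" where
    "f \<theta> = (\<Sum>j\<in>UNIV. of_real (len j) * z $ j * cis (\<theta> $ j))" for \<theta>
  define f' where "f' \<theta> = Blinfun (\<lambda>\<eta>. \<Sum>j\<in>UNIV. of_real (len j) * z $ j * (\<i> * of_real (\<eta> $ j) * cis (\<theta> $ j)))"
    for \<theta> :: "real ^ 'm"
  have lin: "linear (\<lambda>\<eta>::real ^ 'm. \<Sum>j\<in>UNIV. of_real (len j) * z $ j * (\<i> * of_real (\<eta> $ j) * cis (\<theta> $ j)))" for \<theta> :: "real ^ 'm"
    by (rule linearI) (simp_all add: sum.distrib[symmetric] sum_distrib_left scaleR_conv_of_real[where 'a = complex] algebra_simps)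
  have f'_apply: "blinfun_apply (f' \<theta>) =
      (\<lambda>\<eta>. \<Sum>j\<in>UNIV. of_real (len j) * z $ j * (\<i> * of_real (\<eta> $ j) * cis (\<theta> $ j)))" for \<theta>
    unfolding f'_def by (rule bounded_linear_Blinfun_apply) (use lin linear_conv_bounded_linear in blast)
  have "(f has_derivative blinfun_apply (f' \<theta>)) (at \<theta>)" for \<theta>
  proof -
    have nth: "((\<lambda>\<theta>::real ^ 'm. \<theta> $ j) has_derivative (\<lambda>\<eta>. \<eta> $ j)) (at \<theta>)" for j
      by (rule bounded_linear_imp_has_derivative[OF bounded_linear_vec_nth])
    have "((\<lambda>\<theta>. cis (\<theta> $ j)) has_derivative (\<lambda>\<eta>. (\<eta> $ j) *\<^sub>R (\<i> * cis (\<theta> $ j)))) (at \<theta>)" for j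
      using diff_chain_at[OF nth has_vector_derivative_cis[unfolded has_vector_derivative_def]]
      by (simp add: o_def)
    then have "(f has_derivative (\<lambda>\<eta>. \<Sum>j\<in>UNIV. of_real (len j) * z $ j * ((\<eta> $ j) *\<^sub>R (\<i> * cis (\<theta> $ j))))) (at \<theta>)"
      unfolding f_def by (intro has_derivative_sum has_derivative_mult_right)
    then show ?thesis
      by (simp add: f'_apply scaleR_conv_of_real mult_ac)
  qed
  moreover have "continuous_on UNIV f'"
  proof (rule continuous_on_blinfun_componentwise)
    have "continuous_on UNIV (\<lambda>\<theta>::real ^ 'm. cis (\<theta> $ j))" for j
      by (intro continuous_intros)
    then show "continuous_on UNIV (\<lambda>\<theta>. blinfun_apply (f' \<theta>) b)" for b
      unfolding f'_apply by (intro continuous_intros)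
  qed
  (* P is a right inverse of f' 0: the tuple Im z_j - \<kappa> / last_len has no vertical velocity and the
     horizontal velocity - vertical z, a common rotation by 1 / last_len has vertical velocity 1. *)
  moreover define \<kappa> where "\<kappa> = (\<Sum>j\<in>UNIV. len j * Re (z $ j) * Im (z $ j))"
  define P :: "complex \<Rightarrow> real ^ 'm" where
    "P c = (\<chi> j. - (Re c / vertical z) * (Im (z $ j) - \<kappa> / last_len) + Im c / last_len)" for c
  have "bounded_linear P"
    by (rule linear_conv_bounded_linear[THEN iffD1], rule linearI)
       (simp_all add: P_def vec_eq_iff algebra_simps add_divide_distrib)
  moreover have at_0: "blinfun_apply (f' 0) \<eta> =
      Complex (- (\<Sum>j\<in>UNIV. len j * Im (z $ j) * \<eta> $ j)) (\<Sum>j\<in>UNIV. len j * Re (z $ j) * \<eta> $ j)" for \<eta>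
    by (simp add: f'_apply complex_eq_iff sum_negf[symmetric] mult_ac)
  have "blinfun_apply (f' 0) (P c) = c" for c
  proof -
    have "(\<Sum>j\<in>UNIV. len j * Im (z $ j) * P c $ j) =
        - (Re c / vertical z) * (\<Sum>j\<in>UNIV. len j * (Im (z $ j))\<^sup>2) +
        (Re c / vertical z * (\<kappa> / last_len) + Im c / last_len) * (\<Sum>j\<in>UNIV. len j * Im (z $ j))"
      unfolding sum_distrib_left sum.distrib[symmetric]
      by (intro sum.cong) (simp_all add: P_def algebra_simps power2_eq_square)
    also have "\<dots> = - Re c"
      using vertical_pos[OF z] by (simp add: polygon_spaceD(3)[OF z] vertical_def[symmetric])
    finally have 1: "(\<Sum>j\<in>UNIV. len j * Im (z $ j) * P c $ j) = - Re c" .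
    have "(\<Sum>j\<in>UNIV. len j * Re (z $ j) * P c $ j) =
        - (Re c / vertical z) * (\<Sum>j\<in>UNIV. len j * Re (z $ j) * Im (z $ j)) +
        (Re c / vertical z * (\<kappa> / last_len) + Im c / last_len) * (\<Sum>j\<in>UNIV. len j * Re (z $ j))"
      unfolding sum_distrib_left sum.distrib[symmetric]
      by (intro sum.cong) (simp_all add: P_def algebra_simps)
    also have "\<dots> = Im c"
      unfolding polygon_spaceD(2)[OF z] \<kappa>_def[symmetric]
      using last_len_pos by (simp add: field_simps)
    finally show ?thesis
      using 1 by (simp add: at_0 complex_eq_iff)
  qed
  moreover have "blinfun_apply (f' 0) (\<chi> j. t j) = 0"
    using t by (simp add: at_0 closing_def complex_eq_iff)
  ultimately obtain \<theta> where \<theta>: "\<theta> 0 = 0" "(\<theta> has_vector_derivative (\<chi> j. t j)) (at 0)"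
      "\<forall>\<^sub>F s in at 0. f (\<theta> s) = f 0"
    using tangent_curve_in_level_set[of f f' P 0 "\<chi> j. t j"] by blast
  define \<gamma> where "\<gamma> s = (\<chi> j. z $ j * cis (\<theta> s $ j))" for s
  have "\<gamma> 0 = z"
    by (simp add: \<gamma>_def \<theta>(1) vec_eq_iff)
  moreover have "(\<gamma> has_vector_derivative velocity z t) (at 0)"
    unfolding \<gamma>_def velocity_def
  proof (rule has_vector_derivative_vec_lambda)
    fix j
    have "((\<lambda>s. \<theta> s $ j) has_vector_derivative t j) (at 0)"
      using bounded_linear.has_vector_derivative[OF bounded_linear_vec_nth \<theta>(2), of j] by simp
    then have "((\<lambda>s. cis (\<theta> s $ j)) has_vector_derivative t j *\<^sub>R (\<i> * cis (\<theta> 0 $ j))) (at 0)"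
      using vector_diff_chain_at[OF _ has_vector_derivative_cis] by (simp add: o_def)
    from has_vector_derivative_mult_right[OF this, of "z $ j"]
    show "((\<lambda>s. z $ j * cis (\<theta> s $ j)) has_vector_derivative \<i> * of_real (t j) * z $ j) (at 0)"
      by (simp add: \<theta>(1) scaleR_conv_of_real mult_ac)
  qed
  moreover have "\<forall>\<^sub>F s in at 0. \<gamma> s \<in> M"
    using \<theta>(3)
  proof eventually_elim
    case (elim s)
    have "polygon_map l (\<gamma> s) = f (\<theta> s)"
      by (simp add: polygon_map_def \<gamma>_def f_def mult.assoc)
    also have "\<dots> = polygon_map l z"
      unfolding elim by (simp add: polygon_map_def f_def)
    finally show "\<gamma> s \<in> M"
      using z by (auto simp: polygon_space_def torus_def \<gamma>_def norm_mult)
  qed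
  ultimately show ?thesis
    unfolding tangent_vector_def by blast
qed

end



context polygons
begin

definition derivation_of :: "complex ^ 'm \<Rightarrow> ('m \<Rightarrow> real) \<Rightarrow> ((complex ^ 'm) set \<Rightarrow> real) \<Rightarrow> real" where
  "derivation_of z t =
    (\<lambda>f\<in>smooth_algebra. velocity_derivative M (\<lambda>y. f (orbit conjugation y)) z (velocity z t))"

lemma derivation_of_in_derivations:
  "z \<in> M \<Longrightarrow> closing z t \<Longrightarrow> derivation_of z t \<in> derivations (orbit conjugation z)"
  unfolding derivation_of_def by (intro velocity_derivative_in_derivations tangent_vector_velocity)

lemma derivation_of_apply:
  assumes "z \<in> M" and "closing z t" and "f \<in> smooth_algebra"
    and "smooth_extension M (\<lambda>y. f (orbit conjugation y)) z h"
  shows "derivation_of z t f = frechet_derivative h (at z) (velocity z t)"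
  using assms by (simp add: derivation_of_def velocity_derivative_eq tangent_vector_velocity)

text \<open>
  The squares of the norms of the edges and the two coordinates of the end point are constant on the
  polygon space, so the ambient vector of a derivation annihilates them. The former make
  each of its components a multiple of \<open>i z\<^sub>j\<close>, the latter give \<open>closing z t\<close>.
\<close>

lemma derivation_is_velocity:
  assumes z: "z \<in> M" and D: "D \<in> derivations (orbit conjugation z)"
  obtains t where "closing z t" and "D = derivation_of z t"
proof -
  obtain v where v: "\<And>f h. f \<in> smooth_algebra \<Longrightarrow> smooth_extension M (\<lambda>y. f (orbit conjugation y)) z h \<Longrightarrow>
      D f = frechet_derivative h (at z) v"
    using derivation_is_directional[OF z D] by blast
  note const = directional_derivation_constant[OF z D v]
  have bl: "bounded_linear (\<lambda>y::complex ^ 'm. Re (y $ j))" "bounded_linear (\<lambda>y::complex ^ 'm. Im (y $ j))" for j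
    by (rule bounded_linear_compose[OF bounded_linear_Re bounded_linear_vec_nth]
        bounded_linear_compose[OF bounded_linear_Im bounded_linear_vec_nth])+
  note smooth = smooth_on_linear[OF bl(1)] smooth_on_linear[OF bl(2)]
  note deriv = bounded_linear_imp_has_derivative[OF bl(1)] bounded_linear_imp_has_derivative[OF bl(2)]
  have circle: "Re (z $ j) * Re (v $ j) + Im (z $ j) * Im (v $ j) = 0" for j
  proof -
    have "((\<lambda>y::complex ^ 'm. Re (y $ j) * Re (y $ j) + Im (y $ j) * Im (y $ j)) has_derivative
        (\<lambda>v. (Re (z $ j) * Re (v $ j) + Re (v $ j) * Re (z $ j)) +
          (Im (z $ j) * Im (v $ j) + Im (v $ j) * Im (z $ j)))) (at z)"
      by (intro has_derivative_add has_derivative_mult deriv)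
    from frechet_derivative_at[OF this, symmetric]
      const[of "\<lambda>y. Re (y $ j) * Re (y $ j) + Im (y $ j) * Im (y $ j)" 1]
    have "(Re (z $ j) * Re (v $ j) + Re (v $ j) * Re (z $ j)) +
        (Im (z $ j) * Im (v $ j) + Im (v $ j) * Im (z $ j)) = 0"
      using polygon_spaceD(1) by (simp add: smooth_on_add smooth_on_mult smooth power2_eq_square)
    then have "2 * (Re (z $ j) * Re (v $ j) + Im (z $ j) * Im (v $ j)) = 0"
      by (simp add: algebra_simps)
    then show ?thesis
      by simp
  qed
  have end_Re: "(\<Sum>j\<in>UNIV. len j * Re (v $ j)) = 0"
  proof -
    have "((\<lambda>y::complex ^ 'm. \<Sum>j\<in>UNIV. len j * Re (y $ j)) has_derivative
        (\<lambda>v. \<Sum>j\<in>UNIV. len j * Re (v $ j))) (at z)"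
      by (intro has_derivative_sum has_derivative_mult_right deriv)
    from frechet_derivative_at[OF this, symmetric] const[of "\<lambda>y. \<Sum>j\<in>UNIV. len j * Re (y $ j)" last_len]
    show ?thesis
      using polygon_spaceD(2) by (simp add: smooth_on_sum smooth_on_cmult smooth)
  qed
  have end_Im: "(\<Sum>j\<in>UNIV. len j * Im (v $ j)) = 0"
  proof -
    have "((\<lambda>y::complex ^ 'm. \<Sum>j\<in>UNIV. len j * Im (y $ j)) has_derivative
        (\<lambda>v. \<Sum>j\<in>UNIV. len j * Im (v $ j))) (at z)"
      by (intro has_derivative_sum has_derivative_mult_right deriv)
    from frechet_derivative_at[OF this, symmetric] const[of "\<lambda>y. \<Sum>j\<in>UNIV. len j * Im (y $ j)" 0]
    show ?thesis
      using polygon_spaceD(3) by (simp add: smooth_on_sum smooth_on_cmult smooth)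
  qed
  define t where "t j = Re (z $ j) * Im (v $ j) - Im (z $ j) * Re (v $ j)" for j
  have nth: "Re (v $ j) = - (t j * Im (z $ j))" "Im (v $ j) = t j * Re (z $ j)" for j
  proof -
    have "Re (v $ j) = ((Re (z $ j))\<^sup>2 + (Im (z $ j))\<^sup>2) * Re (v $ j)"
      "Im (v $ j) = ((Re (z $ j))\<^sup>2 + (Im (z $ j))\<^sup>2) * Im (v $ j)"
      using polygon_spaceD(1)[OF z, of j] by simp_all
    then show "Re (v $ j) = - (t j * Im (z $ j))" "Im (v $ j) = t j * Re (z $ j)"
      using circle[of j] unfolding t_def by algebra+
  qed
  have "v = velocity z t"
    by (simp add: vec_eq_iff velocity_def complex_eq_iff nth)
  moreover have closing: "closing z t"
    using end_Re end_Im by (simp add: closing_def nth sum_negf mult_ac)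
  ultimately have "D f = derivation_of z t f" if f: "f \<in> smooth_algebra" for f
  proof -
    obtain h where "smooth_extension M (\<lambda>y. f (orbit conjugation y)) z h"
      using f z unfolding mem_smooth_algebra_iff by blast
    then show ?thesis
      using v[OF f] derivation_of_apply[OF z closing f] \<open>v = velocity z t\<close> by simp
  qed
  moreover have "D \<in> extensional smooth_algebra" "derivation_of z t \<in> extensional smooth_algebra"
    using D by (simp_all add: tangent_space_def derivation_of_def)
  ultimately have "D = derivation_of z t"
    by (intro extensionalityI)
  with closing that show thesis
    by blast
qed

definition Re_function :: "'m \<Rightarrow> (complex ^ 'm) set \<Rightarrow> real" where
  "Re_function j = descend (\<lambda>y. Re (y $ j))"

definition Im_Im_function :: "'m \<Rightarrow> 'm \<Rightarrow> (complex ^ 'm) set \<Rightarrow> real" where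
  "Im_Im_function j k = descend (\<lambda>y. Im (y $ j) * Im (y $ k))"

text \<open>
  The angles of the edges are only defined up to a common sign on the quotient, but the
  angular velocities can be recovered from the values of a derivation on finitely many functions
  that are even under conjugation. If \<open>D\<close> is the derivation of the angular velocities \<open>t\<close>, then
  \<open>D (Re z\<^sub>j) = - t\<^sub>j Im z\<^sub>j\<close> and \<open>D (Im z\<^sub>j Im z\<^sub>k) = t\<^sub>j Re z\<^sub>j Im z\<^sub>k + t\<^sub>k Im z\<^sub>j Re z\<^sub>k\<close>.
  The formula combines the latter with the weights \<open>l\<^sub>k Im z\<^sub>k\<close> to isolate \<open>t\<^sub>j Re z\<^sub>j\<close>, and then uses
  \<open>t\<^sub>j = Re z\<^sub>j (t\<^sub>j Re z\<^sub>j) + Im z\<^sub>j (t\<^sub>j Im z\<^sub>j)\<close>.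
\<close>

definition angular_velocity ::
    "complex ^ 'm \<Rightarrow> (((complex ^ 'm) set \<Rightarrow> real) \<Rightarrow> real) \<Rightarrow> 'm \<Rightarrow> real" where
  "angular_velocity z D j =
    Re (z $ j) * ((\<Sum>k\<in>UNIV. len k * Im (z $ k) * D (Im_Im_function j k)) -
      Im (z $ j) * (\<Sum>k\<in>UNIV. len k * D (Im_Im_function k k)) / 2) / vertical z -
    Im (z $ j) * D (Re_function j)"

lemma Re_function_in: "Re_function j \<in> smooth_algebra"
  and smooth_extension_Re_function:
    "smooth_extension M (\<lambda>y. Re_function j (orbit conjugation y)) z (\<lambda>y. Re (y $ j))"
proof -
  have "smooth_on UNIV (\<lambda>y::complex ^ 'm. Re (y $ j))"
    by (rule smooth_on_linear[OF bounded_linear_compose[OF bounded_linear_Re bounded_linear_vec_nth]])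
  from descend_in_smooth_algebra[OF this]
  show "Re_function j \<in> smooth_algebra"
    "smooth_extension M (\<lambda>y. Re_function j (orbit conjugation y)) z (\<lambda>y. Re (y $ j))"
    by (simp_all add: Re_function_def)
qed

lemma Im_Im_function_in: "Im_Im_function j k \<in> smooth_algebra"
  and smooth_extension_Im_Im_function:
    "smooth_extension M (\<lambda>y. Im_Im_function j k (orbit conjugation y)) z (\<lambda>y. Im (y $ j) * Im (y $ k))"
proof -
  have "smooth_on UNIV (\<lambda>y::complex ^ 'm. Im (y $ j))" for j
    by (rule smooth_on_linear[OF bounded_linear_compose[OF bounded_linear_Im bounded_linear_vec_nth]])
  then have "smooth_on UNIV (\<lambda>y::complex ^ 'm. Im (y $ j) * Im (y $ k))"
    by (intro smooth_on_mult)
  from descend_in_smooth_algebra[OF this]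
  show "Im_Im_function j k \<in> smooth_algebra"
    "smooth_extension M (\<lambda>y. Im_Im_function j k (orbit conjugation y)) z (\<lambda>y. Im (y $ j) * Im (y $ k))"
    by (simp_all add: Im_Im_function_def)
qed

lemma angular_velocity_derivation_of:
  assumes z: "z \<in> M" and t: "closing z t"
  shows "angular_velocity z (derivation_of z t) j = t j"
proof -
  let ?D = "derivation_of z t"
  have DRe: "?D (Re_function j) = - (t j * Im (z $ j))" for j
  proof -
    have "((\<lambda>y::complex ^ 'm. Re (y $ j)) has_derivative (\<lambda>v. Re (v $ j))) (at z)"
      by (rule bounded_linear_imp_has_derivative[OF bounded_linear_compose[OF bounded_linear_Re bounded_linear_vec_nth]])
    from frechet_derivative_at[OF this, symmetric] show ?thesis
      using derivation_of_apply[OF z t Re_function_in smooth_extension_Re_function]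
      by (simp add: velocity_nth)
  qed
  have DIm: "?D (Im_Im_function j k) =
      Im (z $ j) * (t k * Re (z $ k)) + t j * Re (z $ j) * Im (z $ k)" for j k
  proof -
    have Im: "((\<lambda>y::complex ^ 'm. Im (y $ j)) has_derivative (\<lambda>v. Im (v $ j))) (at z)" for j
      by (rule bounded_linear_imp_has_derivative[OF bounded_linear_compose[OF bounded_linear_Im bounded_linear_vec_nth]])
    from frechet_derivative_at[OF has_derivative_mult[OF Im Im], symmetric] show ?thesis
      using derivation_of_apply[OF z t Im_Im_function_in smooth_extension_Im_Im_function]
      by (simp add: velocity_nth)
  qed
  have "(\<Sum>k\<in>UNIV. len k * Im (z $ k) * ?D (Im_Im_function j k)) =
      t j * Re (z $ j) * vertical z + Im (z $ j) * (\<Sum>k\<in>UNIV. len k * Im (z $ k) * (t k * Re (z $ k)))"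
    unfolding vertical_def sum_distrib_left sum.distrib[symmetric]
    by (intro sum.cong) (simp_all add: DIm algebra_simps power2_eq_square)
  moreover have "(\<Sum>k\<in>UNIV. len k * ?D (Im_Im_function k k)) =
      2 * (\<Sum>k\<in>UNIV. len k * Im (z $ k) * (t k * Re (z $ k)))"
    unfolding sum_distrib_left by (intro sum.cong) (simp_all add: DIm)
  ultimately have "angular_velocity z ?D j = ((Re (z $ j))\<^sup>2 + (Im (z $ j))\<^sup>2) * t j"
    using vertical_pos[OF z] by (simp add: angular_velocity_def DRe field_simps power2_eq_square)
  then show ?thesis
    by (simp add: polygon_spaceD(1)[OF z])
qed

lemma
  assumes "z \<in> M" and "D \<in> derivations (orbit conjugation z)"
  shows closing_angular_velocity: "closing z (angular_velocity z D)"
    and derivation_of_angular_velocity: "derivation_of z (angular_velocity z D) = D"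
proof -
  obtain t where t: "closing z t" "D = derivation_of z t"
    using derivation_is_velocity[OF assms] by blast
  then have "angular_velocity z D = t"
    using angular_velocity_derivation_of[OF assms(1)] by blast
  with t show "closing z (angular_velocity z D)" "derivation_of z (angular_velocity z D) = D"
    by simp_all
qed

lemma angular_velocity_conjugation: "angular_velocity (conjugation z) D j = - angular_velocity z D j"
  by (simp add: angular_velocity_def sum_negf right_diff_distrib diff_divide_distrib add_divide_distrib)

lemma angular_velocity_add:
  "angular_velocity z (\<lambda>f\<in>smooth_algebra. D f + E f) j = angular_velocity z D j + angular_velocity z E j"
  by (simp add: angular_velocity_def Re_function_in Im_Im_function_in sum.distrib algebra_simps
      add_divide_distrib diff_divide_distrib)

lemma angular_velocity_scale:
  "angular_velocity z (\<lambda>f\<in>smooth_algebra. c * D f) j = c * angular_velocity z D j"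
proof -
  have "(\<Sum>k\<in>UNIV. len k * Im (z $ k) * (c * D (Im_Im_function j k))) =
      c * (\<Sum>k\<in>UNIV. len k * Im (z $ k) * D (Im_Im_function j k))"
    "(\<Sum>k\<in>UNIV. len k * (c * D (Im_Im_function k k))) = c * (\<Sum>k\<in>UNIV. len k * D (Im_Im_function k k))"
    by (simp_all add: sum_distrib_left mult_ac)
  then show ?thesis
    by (simp add: angular_velocity_def Re_function_in Im_Im_function_in algebra_simps)
qed


section \<open>The isomorphism\<close>

definition "stable_tangent_bundle = tangent_M_bar l \<oplus>\<^sub>b trivial_bundle (M_bar l) 1"

lemma M_bar_eq: "M_bar l = quotient_space"
  by (simp add: M_bar_def)

lemma stable_tangent_bundle_simps:
  "base stable_tangent_bundle = quotient_space"
  "proj stable_tangent_bundle ((b, D), (b', s)) = b"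
  "vadd stable_tangent_bundle ((b, D), (b', s)) ((c, E), (c', r)) =
    ((b, \<lambda>f\<in>smooth_algebra. D f + E f), (b', \<lambda>i. s i + r i))"
  "vscale stable_tangent_bundle a ((b, D), (b', s)) = ((b, \<lambda>f\<in>smooth_algebra. a * D f), (b', \<lambda>i. a * s i))"
  by (simp_all add: stable_tangent_bundle_def whitney_sum_def tangent_M_bar_def tangent_bundle_def trivial_bundle_def M_bar_eq)

lemma topspace_stable_tangent_bundle:
  "topspace (total stable_tangent_bundle) =
    {((b, D), (b, s)) | b D s. b \<in> orbit conjugation ` M \<and> D \<in> derivations b \<and> (\<forall>i\<ge>1. s i = 0)}"
proof -
  have "D \<in> extensional smooth_algebra" if "D \<in> derivations b" for D b
    using that by (simp add: tangent_space_def)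
  then have "topspace (total (tangent_M_bar l)) = {(b, D). b \<in> orbit conjugation ` M \<and> D \<in> derivations b}"
    unfolding tangent_M_bar_def tangent_bundle_def M_bar_eq vbundle.simps topspace_subtopology
      topspace_prod_topology topspace_product_topology topspace_quotient_space
    by (auto simp: PiE_UNIV_domain PiE_def)
  moreover have "topspace (total (trivial_bundle (M_bar l) 1)) =
      {(b, s). b \<in> orbit conjugation ` M \<and> (\<forall>i\<ge>1. s i = 0)}"
    unfolding trivial_bundle_def M_bar_eq vbundle.simps topspace_prod_topology topspace_Euclidean_space
      topspace_quotient_space by auto
  ultimately show ?thesis
    unfolding stable_tangent_bundle_def whitney_sum_def vbundle.simps topspace_subtopology topspace_prod_topology
    by (auto simp: tangent_M_bar_def tangent_bundle_def trivial_bundle_def)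
qed

lemma fibre_stable_tangent_bundle:
  assumes "b \<in> orbit conjugation ` M"
  shows "fibre stable_tangent_bundle b =
    {((b, D), (b, s)) | D s. D \<in> derivations b \<and> (\<forall>i\<ge>1. s i = 0)}"
  using assms unfolding fibre_def topspace_stable_tangent_bundle
  by (auto simp: stable_tangent_bundle_simps)

lemma
  shows continuous_map_stable_proj:
      "continuous_map (total stable_tangent_bundle) quotient_space (\<lambda>e. fst (fst e))"
    and continuous_map_stable_derivation: "f \<in> smooth_algebra \<Longrightarrow>
      continuous_map (total stable_tangent_bundle) euclideanreal (\<lambda>e. snd (fst e) f)"
    and continuous_map_stable_scalar:
      "continuous_map (total stable_tangent_bundle) euclideanreal (\<lambda>e. snd (snd e) 0)"
proof -
  let ?T = "prod_topology (total (tangent_M_bar l)) (total (trivial_bundle (M_bar l) 1))"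
  have sub: "continuous_map (total stable_tangent_bundle) Z g" if "continuous_map ?T Z g" for Z :: "'z topology" and g
    using that by (simp add: stable_tangent_bundle_def whitney_sum_def continuous_map_from_subtopology)
  have tangent: "continuous_map (total (tangent_M_bar l))
      (prod_topology quotient_space (product_topology (\<lambda>_. euclideanreal) smooth_algebra)) (\<lambda>x. x)"
    by (simp add: tangent_M_bar_def tangent_bundle_def M_bar_eq continuous_map_from_subtopology)
  have "continuous_map ?T quotient_space (fst \<circ> (\<lambda>x. x) \<circ> fst)"
    by (intro continuous_map_compose[OF continuous_map_fst] continuous_map_compose[OF tangent]
        continuous_map_fst)
  then show "continuous_map (total stable_tangent_bundle) quotient_space (\<lambda>e. fst (fst e))"
    by (intro sub) (simp add: o_def)
  show "continuous_map (total stable_tangent_bundle) euclideanreal (\<lambda>e. snd (fst e) f)"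
    if "f \<in> smooth_algebra"
  proof -
    have "continuous_map ?T euclideanreal ((\<lambda>D. D f) \<circ> snd \<circ> (\<lambda>x. x) \<circ> fst)"
      by (rule continuous_map_compose[OF continuous_map_fst continuous_map_compose[OF tangent
          continuous_map_compose[OF continuous_map_snd continuous_map_product_projection[OF that]]]])
    then show ?thesis
      by (intro sub) (simp add: o_def)
  qed
  have "continuous_map (total (trivial_bundle (M_bar l) 1)) euclideanreal ((\<lambda>s. s 0) \<circ> snd)"
    unfolding trivial_bundle_def vbundle.simps Euclidean_space_def
    by (intro continuous_map_compose[OF continuous_map_snd] continuous_map_from_subtopology
        continuous_map_product_projection) simp
  from continuous_map_compose[OF continuous_map_snd this]
  show "continuous_map (total stable_tangent_bundle) euclideanreal (\<lambda>e. snd (snd e) 0)"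
    by (intro sub) (simp add: o_def)
qed

lemma continuous_map_into_stable_tangent_bundle:
  assumes f: "continuous_map P (top_of_set M) f"
    and t: "\<And>j. continuous_map P euclideanreal (\<lambda>q. t q j)" "\<And>q. q \<in> topspace P \<Longrightarrow> closing (f q) (t q)"
    and r: "continuous_map P euclideanreal r"
  shows "continuous_map P (total stable_tangent_bundle)
    (\<lambda>q. ((orbit conjugation (f q), derivation_of (f q) (t q)),
      (orbit conjugation (f q), \<lambda>i. if i < 1 then r q else 0)))"
proof -
  have f_in: "f q \<in> M" if "q \<in> topspace P" for q
    using continuous_map_in_topspace[OF f that] by simp
  have orb: "continuous_map P quotient_space (\<lambda>q. orbit conjugation (f q))"
    using continuous_map_compose[OF f continuous_map_orbit] by (simp add: o_def)
  have f': "continuous_map P euclidean f"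
    using f by (simp add: continuous_map_in_subtopology)
  have "continuous_map P euclidean (\<lambda>q. (f q, velocity (f q) (t q)))"
  proof -
    have "((\<lambda>q. (f q, velocity (f q) (t q))) \<longlongrightarrow> (f q, velocity (f q) (t q))) (atin P q)"
      if "q \<in> topspace P" for q
    proof -
      have "(f \<longlongrightarrow> f q) (atin P q)" "((\<lambda>q. t q j) \<longlongrightarrow> t q j) (atin P q)" for j
        using f' t(1) that by (simp_all add: continuous_map_atin)
      then show ?thesis
        unfolding velocity_def by (intro tendsto_intros)
    qed
    then show ?thesis
      by (simp add: continuous_map_atin)
  qed
  then have vel: "continuous_map P (top_of_set {(x, v). x \<in> M \<and> tangent_vector M x v})
      (\<lambda>q. (f q, velocity (f q) (t q)))"
    using f_in t(2) tangent_vector_velocity by (auto simp: continuous_map_in_subtopology)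
  have "continuous_map P euclideanreal (\<lambda>q. derivation_of (f q) (t q) g)" if g: "g \<in> smooth_algebra" for g
  proof -
    have "continuous_on {(x, v). x \<in> M \<and> tangent_vector M x v}
        (\<lambda>(x, v). velocity_derivative M (\<lambda>y. g (orbit conjugation y)) x v)"
      using g by (intro continuous_on_velocity_derivative) (auto simp: mem_smooth_algebra_iff)
    from continuous_map_compose_continuous_on[OF vel this] g show ?thesis
      by (simp add: derivation_of_def)
  qed
  moreover have "derivation_of (f q) (t q) \<in> derivations (orbit conjugation (f q))"
    if "q \<in> topspace P" for q
    using derivation_of_in_derivations f_in t(2) that by blast
  moreover have "derivation_of (f q) (t q) \<in> extensional smooth_algebra" for q
    by (simp add: derivation_of_def)
  moreover have "continuous_map P (Euclidean_space 1) (\<lambda>q i. if i < 1 then r q else 0)"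
    unfolding continuous_map_componentwise_Euclidean_space using r by blast
  ultimately show ?thesis
    using orb unfolding stable_tangent_bundle_def whitney_sum_def tangent_M_bar_def tangent_bundle_def trivial_bundle_def M_bar_eq
    by (auto simp: continuous_map_in_subtopology continuous_map_pairwise o_def
        continuous_map_componentwise)
qed

lemma closed_stable_tangent_bundle:
  assumes "b \<in> orbit conjugation ` M" and "e \<in> fibre stable_tangent_bundle b"
  shows "e' \<in> fibre stable_tangent_bundle b \<Longrightarrow> vadd stable_tangent_bundle e e' \<in> fibre stable_tangent_bundle b"
    and "vscale stable_tangent_bundle c e \<in> fibre stable_tangent_bundle b"
  using assms derivations_add derivations_scale unfolding fibre_stable_tangent_bundle[OF assms(1)]
  by (auto simp: stable_tangent_bundle_simps)

definition relative_velocity ::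
    "'m \<Rightarrow> complex ^ 'm \<Rightarrow> (((complex ^ 'm) set \<Rightarrow> real) \<Rightarrow> real) \<Rightarrow> real \<Rightarrow> 'm \<Rightarrow> real" where
  "relative_velocity j\<^sub>0 z D s j =
    (angular_velocity z D j + s * Im (z $ j)) - (angular_velocity z D j\<^sub>0 + s * Im (z $ j\<^sub>0))"

lemma relative_velocity_conjugation:
  "relative_velocity j\<^sub>0 (conjugation z) D s j = - relative_velocity j\<^sub>0 z D s j"
  by (simp add: relative_velocity_def angular_velocity_conjugation)

text \<open>
  Equal relative velocities mean that the angular velocities differ by \<open>c - (s - r) Im z\<^sub>j\<close> for
  a constant \<open>c\<close>. As both tuples fix the end point, its horizontal velocity
  gives \<open>s = r\<close>, and its vertical velocity gives \<open>c = 0\<close>.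
\<close>

lemma relative_velocity_inject:
  assumes z: "z \<in> M" and D: "D \<in> derivations (orbit conjugation z)" and E: "E \<in> derivations (orbit conjugation z)"
    and eq: "\<And>j. relative_velocity j\<^sub>0 z D s j = relative_velocity j\<^sub>0 z E r j"
  shows "D = E" and "s = r"
proof -
  define c where "c = (angular_velocity z D j\<^sub>0 + s * Im (z $ j\<^sub>0)) - (angular_velocity z E j\<^sub>0 + r * Im (z $ j\<^sub>0))"
  have diff: "angular_velocity z D j - angular_velocity z E j = c - (s - r) * Im (z $ j)" for j
    using eq[of j] by (simp add: relative_velocity_def c_def algebra_simps)
  note closing = closing_angular_velocity[OF z D] closing_angular_velocity[OF z E]
  have "0 = (\<Sum>j\<in>UNIV. len j * Im (z $ j) * (angular_velocity z D j - angular_velocity z E j))"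
    using closing by (simp add: closing_def right_diff_distrib sum_subtractf)
  also have "\<dots> = c * (\<Sum>j\<in>UNIV. len j * Im (z $ j)) - (s - r) * vertical z"
    unfolding vertical_def sum_distrib_left sum_subtractf[symmetric] diff
    by (intro sum.cong) (simp_all add: algebra_simps power2_eq_square)
  finally show sr: "s = r"
    using vertical_pos[OF z] by (simp add: polygon_spaceD(3)[OF z])
  have "0 = (\<Sum>j\<in>UNIV. len j * Re (z $ j) * (angular_velocity z D j - angular_velocity z E j))"
    using closing by (simp add: closing_def right_diff_distrib sum_subtractf)
  also have "\<dots> = c * (\<Sum>j\<in>UNIV. len j * Re (z $ j))"
    unfolding diff sr sum_distrib_left by (intro sum.cong) simp_all
  finally have "c = 0"
    using last_len_pos by (simp add: polygon_spaceD(2)[OF z])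
  then have "angular_velocity z D = angular_velocity z E"
    using diff sr by (simp add: fun_eq_iff)
  then have "derivation_of z (angular_velocity z D) = derivation_of z (angular_velocity z E)"
    by (rule arg_cong)
  then show "D = E"
    unfolding derivation_of_angular_velocity[OF z D] derivation_of_angular_velocity[OF z E] .
qed

text \<open>
  The inverse of \<open>relative_velocity\<close>: from a tuple \<open>w\<close>, first a multiple of \<open>j \<mapsto> Im z\<^sub>j\<close> is subtracted so
  that the end point has no horizontal velocity, and then a common rotation so that it has no
  vertical velocity.
\<close>

definition scalar_part :: "complex ^ 'm \<Rightarrow> ('m \<Rightarrow> real) \<Rightarrow> real" where
  "scalar_part z w = (\<Sum>j\<in>UNIV. len j * Im (z $ j) * w j) / vertical z"

definition closing_part :: "complex ^ 'm \<Rightarrow> ('m \<Rightarrow> real) \<Rightarrow> 'm \<Rightarrow> real" where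
  "closing_part z w j = w j - scalar_part z w * Im (z $ j) -
    (\<Sum>k\<in>UNIV. len k * Re (z $ k) * (w k - scalar_part z w * Im (z $ k))) / last_len"

lemma closing_closing_part:
  assumes "z \<in> M"
  shows "closing z (closing_part z w)"
proof -
  let ?s = "scalar_part z w"
  let ?c = "(\<Sum>k\<in>UNIV. len k * Re (z $ k) * (w k - ?s * Im (z $ k))) / last_len"
  have "(\<Sum>j\<in>UNIV. len j * Re (z $ j) * closing_part z w j) =
      (\<Sum>j\<in>UNIV. len j * Re (z $ j) * (w j - ?s * Im (z $ j))) - ?c * (\<Sum>j\<in>UNIV. len j * Re (z $ j))"
    unfolding sum_distrib_left sum_subtractf[symmetric]
    by (intro sum.cong) (simp_all add: closing_part_def algebra_simps)
  also have "\<dots> = 0"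
    using last_len_pos by (simp add: polygon_spaceD(2)[OF assms])
  finally have re: "(\<Sum>j\<in>UNIV. len j * Re (z $ j) * closing_part z w j) = 0" .
  have "(\<Sum>j\<in>UNIV. len j * Im (z $ j) * closing_part z w j) =
      (\<Sum>j\<in>UNIV. len j * Im (z $ j) * w j) - ?s * vertical z - ?c * (\<Sum>j\<in>UNIV. len j * Im (z $ j))"
    unfolding vertical_def sum_distrib_left sum_subtractf[symmetric]
    by (intro sum.cong) (simp_all add: closing_part_def algebra_simps power2_eq_square)
  also have "\<dots> = 0"
    using vertical_pos[OF assms] by (simp add: polygon_spaceD(3)[OF assms] scalar_part_def)
  finally show ?thesis
    using re by (simp add: closing_def)
qed

lemma relative_velocity_closing_part:
  assumes "z \<in> M" and "w j\<^sub>0 = 0"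
  shows "relative_velocity j\<^sub>0 z (derivation_of z (closing_part z w)) (scalar_part z w) j = w j"
  unfolding relative_velocity_def angular_velocity_derivation_of[OF assms(1) closing_closing_part[OF assms(1)]]
  by (simp add: closing_part_def assms(2))

lemma stable_tangent_bundle_iso:
  assumes card: "CARD('m) = Suc k"
  shows "\<exists>h. bundle_iso stable_tangent_bundle (multiple k) h"
proof -
  obtain j\<^sub>0 :: 'm where True by blast
  have "card (UNIV - {j\<^sub>0}) = card {..<k}"
    using card by (simp add: card_Diff_singleton)
  then obtain \<pi> where \<pi>: "bij_betw \<pi> {..<k} (UNIV - {j\<^sub>0})"
    using finite_same_card_bij[of "{..<k}" "UNIV - {j\<^sub>0}"] by auto
  define \<iota> where "\<iota> = inv_into {..<k} \<pi>"
  have \<iota>: "\<iota> j < k" "\<pi> (\<iota> j) = j" if "j \<noteq> j\<^sub>0" for j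
    using bij_betw_inv_into_right[OF \<pi>, of j] bij_betw_apply[OF bij_betw_inv_into[OF \<pi>], of j] that
    by (auto simp: \<iota>_def)
  have \<pi>_ne: "\<pi> i \<noteq> j\<^sub>0" and \<iota>_\<pi>: "\<iota> (\<pi> i) = i" if "i < k" for i
    using bij_betw_apply[OF \<pi>, of i] bij_betw_inv_into_left[OF \<pi>, of i] that by (auto simp: \<iota>_def)
  define H where "H z D s = (orbit conjugation z, \<lambda>i\<in>{..<k}. line_class z (relative_velocity j\<^sub>0 z D s (\<pi> i)))"
    for z D s
  have H_conj: "H (conjugation z) D s = H z D s" for z D s
    by (simp add: H_def relative_velocity_conjugation line_class_\<sigma>)
  define h where "h e = H (SOME z. z \<in> fst (fst e)) (snd (fst e)) (snd (snd e) 0)"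
    for e :: "((complex ^ 'm) set \<times> (((complex ^ 'm) set \<Rightarrow> real) \<Rightarrow> real)) \<times> (complex ^ 'm) set \<times> (nat \<Rightarrow> real)"
  have h_eq: "h ((orbit conjugation z, D), (b, s)) = H z D (s 0)" for z D b s
  proof -
    have "(SOME y. y \<in> orbit conjugation z) \<in> orbit conjugation z"
      by (rule someI[of _ z]) (simp add: orbit_def)
    then show ?thesis
      using H_conj by (auto simp: h_def orbit_def)
  qed
  have total: "\<exists>z D s. z \<in> M \<and> e = ((orbit conjugation z, D), (orbit conjugation z, s)) \<and>
      D \<in> derivations (orbit conjugation z) \<and> (\<forall>i\<ge>1. s i = 0)"
    if "e \<in> topspace (total stable_tangent_bundle)" for e
    using that unfolding topspace_stable_tangent_bundle by blast
  have real_Re: "continuous_on M (\<lambda>z. Re (z $ j))" and real_Im: "continuous_on M (\<lambda>z. Im (z $ j))"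
    and real_vertical: "continuous_on M vertical" for j
    unfolding vertical_def by (intro continuous_intros)+
  have hom: "homeomorphic_map (total stable_tangent_bundle) (total (multiple k)) h"
  proof (rule homeomorphic_map_over_open_map[OF open_map_orbit orbit_image_topspace continuous_map_proj_multiple])
    let ?P = "fibre_product (top_of_set M) (total stable_tangent_bundle) (orbit conjugation) (\<lambda>e. fst (fst e))"
    show "continuous_map (total stable_tangent_bundle) (total (multiple k)) h"
    proof (rule continuous_map_over_open_map[OF open_map_orbit orbit_image_topspace continuous_map_stable_proj])
      note real = continuous_map_compose_continuous_on[OF continuous_map_fibre_product_fst]
      have D: "continuous_map ?P euclideanreal (\<lambda>q. snd (fst (snd q)) f)" if "f \<in> smooth_algebra" for f
        using continuous_map_compose[OF continuous_map_fibre_product_snd continuous_map_stable_derivation[OF that]]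
        by (simp add: o_def)
      have s: "continuous_map ?P euclideanreal (\<lambda>q. snd (snd (snd q)) 0)"
        using continuous_map_compose[OF continuous_map_fibre_product_snd continuous_map_stable_scalar]
        by (simp add: o_def)
      have "vertical (fst q) \<noteq> 0" if "q \<in> topspace ?P" for q
        using that vertical_pos[of "fst q"] by (auto simp: topspace_fibre_product)
      then have "continuous_map ?P euclideanreal (\<lambda>q. angular_velocity (fst q) (snd (fst (snd q))) j)" for j
        unfolding angular_velocity_def
        by (intro continuous_map_real_mult continuous_map_diff continuous_map_real_divide continuous_map_sum
            real[OF real_Re] real[OF real_Im] real[OF real_vertical] D Re_function_in Im_Im_function_in
            continuous_map_const[THEN iffD2]) auto
      then have "continuous_map ?P euclideanreal
          (\<lambda>q. relative_velocity j\<^sub>0 (fst q) (snd (fst (snd q))) (snd (snd (snd q)) 0) j)" for j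
        unfolding relative_velocity_def
        by (intro continuous_map_real_mult continuous_map_diff continuous_map_add real[OF real_Im] s)
      then have "continuous_map ?P (total (multiple k)) (\<lambda>q. H (fst q) (snd (fst (snd q))) (snd (snd (snd q)) 0))"
        unfolding H_def by (rule continuous_map_into_multiple[OF continuous_map_fibre_product_fst])
      then show "continuous_map ?P (total (multiple k)) (\<lambda>(z, e). h e)"
      proof (rule continuous_map_eq)
        fix q assume "q \<in> topspace ?P"
        then have "orbit conjugation (fst q) = fst (fst (snd q))"
          by (auto simp: topspace_fibre_product)
        then show "H (fst q) (snd (fst (snd q))) (snd (snd (snd q)) 0) = (\<lambda>(z, e). h e) q"
          using h_eq[of "fst q" "snd (fst (snd q))" "fst (snd (snd q))" "snd (snd (snd q))"]
          by (simp add: split_beta)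
      qed
    qed
    show "inj_on h (topspace (total stable_tangent_bundle))"
    proof (rule inj_onI)
      fix e e' assume "e \<in> topspace (total stable_tangent_bundle)" "e' \<in> topspace (total stable_tangent_bundle)"
        and eq: "h e = h e'"
      then obtain z D s z' D' s' where z: "z \<in> M" and e: "e = ((orbit conjugation z, D), (orbit conjugation z, s))"
          "D \<in> derivations (orbit conjugation z)" "\<forall>i\<ge>1. s i = 0"
        and e': "e' = ((orbit conjugation z', D'), (orbit conjugation z', s'))"
          "D' \<in> derivations (orbit conjugation z')" "\<forall>i\<ge>1. s' i = 0"
        using total by metis
      have orb: "orbit conjugation z' = orbit conjugation z"
        using eq unfolding e(1) e'(1) h_eq by (simp add: H_def)
      have "H z D (s 0) = H z D' (s' 0)"
        using eq unfolding e(1) e'(1) orb h_eq .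
      then have fun_eq: "(\<lambda>i\<in>{..<k}. line_class z (relative_velocity j\<^sub>0 z D (s 0) (\<pi> i))) =
          (\<lambda>i\<in>{..<k}. line_class z (relative_velocity j\<^sub>0 z D' (s' 0) (\<pi> i)))"
        by (simp add: H_def)
      have "relative_velocity j\<^sub>0 z D (s 0) j = relative_velocity j\<^sub>0 z D' (s' 0) j" for j
      proof (cases "j = j\<^sub>0")
        case True
        then show ?thesis
          by (simp add: relative_velocity_def)
      next
        case False
        then show ?thesis
          using fun_cong[OF fun_eq, of "\<iota> j"] \<iota>[OF False] by (simp add: line_class_inject[OF z])
      qed
      from relative_velocity_inject[OF z e(2) e'(2)[unfolded orb] this]
      have "D = D'" "s 0 = s' 0" .
      moreover have "s = s'"
      proof
        show "s i = s' i" for i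
          using \<open>s 0 = s' 0\<close> e(3) e'(3) by (cases i) auto
      qed
      ultimately show "e = e'"
        unfolding e(1) e'(1) orb by simp
    qed
    (* The coordinates of the fibre of the line bundle are relative velocities to the edge j0, whose
       own relative velocity is 0. *)
    let ?Q = "fibre_product (top_of_set M) (total (multiple k)) (orbit conjugation) fst"
    define w where "w z y j = (if j = j\<^sub>0 then 0 else line_coordinate z (snd y (\<iota> j)))"
      for z and y :: "(complex ^ 'm) set \<times> (nat \<Rightarrow> ((complex ^ 'm) \<times> real) set)" and j
    define G where "G z y = ((orbit conjugation z, derivation_of z (closing_part z (w z y))),
        (orbit conjugation z, \<lambda>i::nat. if i < 1 then scalar_part z (w z y) else 0))" for z y
    note real = continuous_map_compose_continuous_on[OF continuous_map_fibre_product_fst]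
    have w: "continuous_map ?Q euclideanreal (\<lambda>q. w (fst q) (snd q) j)" for j
    proof (cases "j = j\<^sub>0")
      case False
      have "continuous_map ?Q (total line_bundle) (\<lambda>q. snd (snd q) (\<iota> j))"
        using continuous_map_compose[OF continuous_map_fibre_product_snd
            continuous_map_multiple_component[OF \<iota>(1)[OF False]]] by (simp add: o_def)
      from continuous_map_line_coordinate[OF continuous_map_fibre_product_fst this] False
      show ?thesis
        by (simp add: w_def)
    qed (simp add: w_def)
    have "vertical (fst q) \<noteq> 0" if "q \<in> topspace ?Q" for q
      using that vertical_pos[of "fst q"] by (auto simp: topspace_fibre_product)
    then have scalar: "continuous_map ?Q euclideanreal (\<lambda>q. scalar_part (fst q) (w (fst q) (snd q)))"
      unfolding scalar_part_def
      by (intro continuous_map_real_mult continuous_map_real_divide continuous_map_sum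
          real[OF real_Im] real[OF real_vertical] w continuous_map_const[THEN iffD2]) auto
    have "continuous_map ?Q euclideanreal (\<lambda>q. closing_part (fst q) (w (fst q) (snd q)) j)" for j
      unfolding closing_part_def using last_len_pos
      by (intro continuous_map_real_mult continuous_map_real_divide continuous_map_diff continuous_map_sum
          real[OF real_Im] real[OF real_Re] w scalar continuous_map_const[THEN iffD2]) auto
    then have "continuous_map ?Q (total stable_tangent_bundle) (\<lambda>q. G (fst q) (snd q))"
      unfolding G_def
      by (intro continuous_map_into_stable_tangent_bundle continuous_map_fibre_product_fst scalar
          closing_closing_part) (auto simp: topspace_fibre_product)
    then show "continuous_map ?Q (total stable_tangent_bundle) (\<lambda>(z, y). G z y)"
      by (simp add: split_beta')
    show "h (G z y) = y" if z: "z \<in> topspace (top_of_set M)" and y: "y \<in> topspace (total (multiple k))"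
      and orb: "orbit conjugation z = fst y" for z y
    proof -
      have "z \<in> M"
        using z by simp
      moreover have "y \<in> fibre (multiple k) (orbit conjugation z)"
        using y orb by (simp add: fibre_def multiple_simps)
      ultimately obtain t where t: "y = (orbit conjugation z, \<lambda>i\<in>{..<k}. line_class z (t i))"
        by (auto simp: fibre_multiple)
      have "relative_velocity j\<^sub>0 z (derivation_of z (closing_part z (w z y))) (scalar_part z (w z y)) (\<pi> i) = t i"
        if "i < k" for i
        using relative_velocity_closing_part[of z "w z y" j\<^sub>0 "\<pi> i"] \<open>z \<in> M\<close> \<pi>_ne[OF that] \<iota>_\<pi>[OF that] that
        by (simp add: w_def t line_coordinate_line_class)
      then show ?thesis
        unfolding G_def h_eq H_def t by (auto intro!: restrict_ext)
    qed
  qed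
  have "bundle_iso stable_tangent_bundle (multiple k) h"
    unfolding bundle_iso_def
  proof (intro conjI ballI allI)
    show "proj (multiple k) (h e) = proj stable_tangent_bundle e" if "e \<in> topspace (total stable_tangent_bundle)" for e
      using total[OF that] by (auto simp: h_eq H_def multiple_simps stable_tangent_bundle_simps)
    show "h (vscale stable_tangent_bundle c e) = vscale (multiple k) c (h e)"
      if "e \<in> topspace (total stable_tangent_bundle)" for e c
    proof -
      have "relative_velocity j\<^sub>0 z (\<lambda>f\<in>smooth_algebra. c * D f) (c * s) j = c * relative_velocity j\<^sub>0 z D s j" for z D s j
        by (simp add: relative_velocity_def angular_velocity_scale algebra_simps)
      then show ?thesis
        using total[OF that] by (auto simp: h_eq H_def multiple_simps stable_tangent_bundle_simps)
    qed
    show "h (vadd stable_tangent_bundle e e') = vadd (multiple k) (h e) (h e')"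
      if b: "b \<in> topspace (base stable_tangent_bundle)"
        and e: "e \<in> fibre stable_tangent_bundle b" "e' \<in> fibre stable_tangent_bundle b" for b e e'
    proof -
      obtain z where z: "z \<in> M" "b = orbit conjugation z"
        using b by (auto simp: stable_tangent_bundle_simps topspace_quotient_space)
      obtain D s D' s' where "e = ((b, D), (b, s))" "e' = ((b, D'), (b, s'))"
        using e z fibre_stable_tangent_bundle[of b] by auto
      moreover have "relative_velocity j\<^sub>0 z (\<lambda>f\<in>smooth_algebra. D f + D' f) (s + s') j =
          relative_velocity j\<^sub>0 z D s j + relative_velocity j\<^sub>0 z D' s' j" for D D' s s' j
        by (simp add: relative_velocity_def angular_velocity_add algebra_simps)
      ultimately show ?thesis
        unfolding z(2) by (simp add: h_eq H_def multiple_simps(3)[OF z(1)] stable_tangent_bundle_simps)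
    qed
  qed (rule hom)
  then show ?thesis
    by blast
qed

end

theorem theorem1p1:
  fixes n :: nat and l :: "real ^ 'm::finite option"
  assumes "CARD('m option) = n" and "n \<ge> 3"
    and "length_vector l" and "generic l"
  shows "tangent_M_bar l \<oplus>\<^sub>b trivial_bundle (M_bar l) 1
           \<approx>\<^sub>b whitney_multiple (n - 2) (canonical_line_bundle l)"
proof -
  interpret polygons l
    by unfold_locales (fact assms)+
  have "CARD('m) = Suc (n - 2)"
    using assms(1,2) by (simp add: card_UNIV_option)
  then obtain h where h: "bundle_iso stable_tangent_bundle (multiple (n - 2)) h"
    using stable_tangent_bundle_iso by blast
  have "proj stable_tangent_bundle = (\<lambda>e. fst (fst e))"
    by (auto simp: stable_tangent_bundle_def whitney_sum_def tangent_M_bar_def tangent_bundle_def)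
  then have "vector_bundle stable_tangent_bundle"
    using continuous_map_stable_proj closed_stable_tangent_bundle
    by (intro vector_bundle_transport[OF h vector_bundle_multiple])
       (auto simp: stable_tangent_bundle_simps multiple_simps topspace_quotient_space)
  then show ?thesis
    using h vector_bundle_multiple
    unfolding isomorphic_bundles_def canonical_line_bundle_def stable_tangent_bundle_def[symmetric]
    by (auto simp: stable_tangent_bundle_simps multiple_simps)
qed

end
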